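(* For every $N\in\{70,143\}$ and every subset $A\subseteq\mathbb{Z}_N$, $$\det \mathcal{F}_N[A,A]\neq 0.$$
   Context: For an integer $N\ge 2$, $\mathbb{Z}_N=\mathbb{Z}/N\mathbb{Z}$ and the Fourier matrix of order $N$ is the complex matrix $\mathcal{F}_N=(\omega_N^{ij})_{i,j\in\mathbb{Z}_N}$ with $\omega_N=e^{-2\pi i/N}$ (in this last expression $i$ is the imaginary unit). For $R,C\subseteq\mathbb{Z}_N$ of equal cardinality, $\mathcal{F}_N[R,C]$ is the submatrix with rows indexed by $R$ and columns indexed by $C$. By convention $\det\mathcal{F}_N[\varnothing,\varnothing]=1$. *)

theory Defs
  imports
    Complex_Main
    "Jordan_Normal_Form.Determinant"
    "Jordan_Normal_Form.DL_Submatrix"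
begin

(* The ring Z/NZ is represented by the residues {0..<N}; the entry
   \<omega>^(i*j) depends only on the classes of i and j modulo N. *)

definition fourier_root :: "nat \<Rightarrow> complex" where
  "fourier_root N = exp (- (2 * of_real pi * \<i> / of_nat N))"

definition fourier_matrix :: "nat \<Rightarrow> complex mat" where
  "fourier_matrix N = mat N N (\<lambda>(i, j). fourier_root N ^ (i * j))"

(* The library operation submatrix M R C lists the chosen rows and columns in
   increasing order.  For R = C the determinant does not depend on the order,
   since rows and columns are permuted simultaneously.  The empty minor is 1: *)

lemma det_submatrix_empty: "Determinant.det (submatrix (fourier_matrix N) {} {}) = 1"
  by (simp add: submatrix_def Determinant.det_def)

end

theory Submission
  imports Defs "HOL-Number_Theory.Cong"
begin

text \<open>Write \<open>N = p m\<close> with \<open>(p, m) = (7, 10)\<close> or \<open>(13, 11)\<close>, and let \<open>\<zeta>\<close> and \<open>\<alpha>\<close> be the powers of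
  \<open>\<omega>\<^sub>N\<close> of order \<open>p\<close> and \<open>m\<close>. If \<open>v\<close> is in the kernel of the principal submatrix on \<open>A\<close>, let
  \<open>V\<close> be the \<open>\<int>[\<omega>\<^sub>N]\<close>-module generated by its entries. Modulo \<open>\<zeta> - 1\<close> the powers of \<open>\<zeta>\<close> become
  polynomials, as in Chebotarev's theorem, and the submatrix becomes block triangular up to scaling,
  with principal submatrices of the Fourier matrix of order \<open>m\<close> on the diagonal. If these are
  invertible modulo \<open>p\<close>, then \<open>V = (\<zeta> - 1) V\<close>, hence \<open>V = p V\<close> since \<open>p\<close> divides
  \<open>(\<zeta> - 1)\<^sup>p\<close>, and \<open>V = 0\<close> by Nakayama's lemma.

  Invertibility modulo \<open>p\<close> of the minors of order \<open>m\<close> is a finite computation. A minor may be replaced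
  by the complementary one, so at most five rows are needed, and \<open>p\<close> is inert in \<open>\<rat>(\<alpha>)\<close>, so one can test
  the norm of the determinant.\<close>

section \<open>Modules over rings of cyclotomic integers\<close>

definition primitive_root :: "nat \<Rightarrow> complex \<Rightarrow> bool" where
  "primitive_root m \<alpha> \<longleftrightarrow> m > 0 \<and> (\<forall>k. \<alpha> ^ k = 1 \<longleftrightarrow> m dvd k)"

lemma primitive_root_pow_eq_1: "primitive_root m \<alpha> \<Longrightarrow> \<alpha> ^ k = 1 \<longleftrightarrow> m dvd k"
  by (simp add: primitive_root_def)

lemma primitive_root_pos: "primitive_root m \<alpha> \<Longrightarrow> m > 0"
  by (simp add: primitive_root_def)

lemma pow_cong:
  fixes \<alpha> :: complex
  assumes "\<alpha> ^ m = 1" "[i = j] (mod m)"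
  shows "\<alpha> ^ i = \<alpha> ^ j"
proof -
  have "\<alpha> ^ i = \<alpha> ^ (i mod m)" for i
    by (metis assms(1) mod_mult_div_eq mult.commute mult_1 power_add power_mult power_one)
  then show ?thesis using assms(2) by (metis cong_def)
qed

lemma primitive_root_pow_coprime:
  assumes "primitive_root m \<alpha>" "coprime a m"
  shows "primitive_root m (\<alpha> ^ a)"
proof -
  have "(\<alpha> ^ a) ^ k = 1 \<longleftrightarrow> m dvd k" for k
    using assms by (simp add: primitive_root_pow_eq_1 coprime_dvd_mult_right_iff coprime_commute
      flip: power_mult)
  then show ?thesis using assms(1) by (simp add: primitive_root_def)
qed

lemma sum_powers_root_of_unity:
  fixes \<gamma> :: complex
  assumes "\<gamma> ^ m = 1" "\<gamma> \<noteq> 1"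
  shows "(\<Sum>i<m. \<gamma> ^ i) = 0"
  using assms by (simp add: geometric_sum)

text \<open>Membership in \<open>W\<close> stands for vanishing in a quotient by \<open>W\<close>.
  Both \<open>V\<close> and \<open>(\<zeta> - 1) V\<close> occur as instances.\<close>

locale root_module =
  fixes \<alpha> :: complex and W :: "complex set"
  assumes zero: "0 \<in> W"
    and diff: "x \<in> W \<Longrightarrow> y \<in> W \<Longrightarrow> x - y \<in> W"
    and mult: "x \<in> W \<Longrightarrow> \<alpha> * x \<in> W"
begin

lemma uminus: "x \<in> W \<Longrightarrow> - x \<in> W"
  using diff[OF zero] by simp

lemma add: "x \<in> W \<Longrightarrow> y \<in> W \<Longrightarrow> x + y \<in> W"
  using diff[of x "- y"] uminus by simp

lemma sum: "(\<And>i. i \<in> I \<Longrightarrow> f i \<in> W) \<Longrightarrow> sum f I \<in> W"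
  by (induction I rule: infinite_finite_induct) (auto simp: zero add)

lemma pow: "x \<in> W \<Longrightarrow> \<alpha> ^ k * x \<in> W"
  by (induction k) (auto simp: mult mult.assoc)

lemma of_nat: "x \<in> W \<Longrightarrow> of_nat k * x \<in> W"
  by (induction k) (auto simp: zero add algebra_simps)

lemma of_int: "x \<in> W \<Longrightarrow> of_int k * x \<in> W"
  by (cases k rule: int_cases2) (auto simp: of_nat uminus)

text \<open>Bezout. With \<open>a = p\<close>, integers prime to \<open>p\<close> can be cancelled
  on elements killed by \<open>p\<close> modulo \<open>W\<close>.\<close>

lemma cancel_coprime:
  assumes "coprime a b" "of_int a * x \<in> W" "of_int b * x \<in> W"
  shows "x \<in> W"
proof -
  obtain r s where rs: "r * a + s * b = 1"
    using bezout_int[of a b] assms(1) by (auto simp: coprime_iff_gcd_eq_1)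
  have "x = of_int (r * a + s * b) * x" by (simp add: rs)
  also have "\<dots> = of_int r * (of_int a * x) + of_int s * (of_int b * x)"
    by (simp add: algebra_simps)
  also have "\<dots> \<in> W" by (intro add of_int assms)
  finally show ?thesis .
qed

lemma root_module_pow: "root_module (\<alpha> ^ k) W"
  by unfold_locales (auto intro: zero diff pow)

lemma root_module_scale: "root_module \<alpha> ((*) t ` W)"
proof
  show "0 \<in> (*) t ` W" using zero by force
  show "x - y \<in> (*) t ` W" if "x \<in> (*) t ` W" "y \<in> (*) t ` W" for x y
    using that by (auto simp flip: right_diff_distrib intro: diff)
  show "\<alpha> * x \<in> (*) t ` W" if "x \<in> (*) t ` W" for x
    using that by (auto simp: mult.left_commute intro: mult)
qed

end

text \<open>Says that the submatrix of the Fourier matrix of order \<open>m\<close> with rows and columns \<open>Y\<close> is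
  invertible over \<open>\<int>[\<alpha>]/p\<close>. Quantifying over submodules \<open>W\<close> of the complex numbers and vectors
  \<open>u\<close> with \<open>p u\<close> in \<open>W\<close> avoids constructing this quotient ring.\<close>

definition invertible_mod :: "nat \<Rightarrow> nat \<Rightarrow> nat set \<Rightarrow> bool" where
  "invertible_mod p m Y \<longleftrightarrow> (\<forall>\<alpha> W u. primitive_root m \<alpha> \<longrightarrow> root_module \<alpha> W \<longrightarrow>
     (\<forall>y\<in>Y. of_nat p * u y \<in> W) \<longrightarrow> (\<forall>x\<in>Y. (\<Sum>y\<in>Y. \<alpha> ^ (x * y) * u y) \<in> W) \<longrightarrow>
     (\<forall>y\<in>Y. u y \<in> W))"

lemma invertible_modD:
  assumes "invertible_mod p m Y" "primitive_root m \<alpha>" "root_module \<alpha> W"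
    "\<And>y. y \<in> Y \<Longrightarrow> of_nat p * u y \<in> W" "\<And>x. x \<in> Y \<Longrightarrow> (\<Sum>y\<in>Y. \<alpha> ^ (x * y) * u y) \<in> W"
    "y \<in> Y"
  shows "u y \<in> W"
  using assms unfolding invertible_mod_def by blast

text \<open>Orthogonality of characters; \<open>\<alpha> ^ (m - 1)\<close> is the inverse of
  \<open>\<alpha>\<close> written with a natural exponent.\<close>

lemma fourier_inversion:
  assumes \<alpha>: "primitive_root m \<alpha>" and Y: "Y \<subseteq> {..<m}" and z: "z < m"
  shows "(\<Sum>x<m. (\<alpha> ^ (m - 1)) ^ (z * x) * (\<Sum>y\<in>Y. \<alpha> ^ (x * y) * u y))
    = (if z \<in> Y then of_nat m * u z else 0)"
proof -
  have fin: "finite Y" using Y finite_subset by blast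
  define \<gamma> where "\<gamma> y = \<alpha> ^ ((m - 1) * z + y)" for y
  have orth: "(\<Sum>x<m. \<gamma> y ^ x) = (if y = z then of_nat m else 0)" if "y < m" for y
  proof -
    obtain m' where m': "m = Suc m'" using z by (cases m) auto
    have "int ((m - 1) * z + y) = int m * int z + (int y - int z)"
      by (simp add: m' algebra_simps)
    then have "m dvd (m - 1) * z + y \<longleftrightarrow> int m dvd (int y - int z)"
      by (metis dvd_add_right_iff dvd_triv_left int_dvd_int_iff)
    also have "\<dots> \<longleftrightarrow> y = z" using that z
      by (metis cong_iff_dvd_diff cong_int_iff cong_less_modulus_unique_nat cong_refl)
    finally have "\<gamma> y = 1 \<longleftrightarrow> y = z"
      by (simp add: \<gamma>_def primitive_root_pow_eq_1[OF \<alpha>])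
    moreover have "\<gamma> y ^ m = 1"
      unfolding \<gamma>_def power_mult[symmetric] primitive_root_pow_eq_1[OF \<alpha>] by simp
    ultimately show ?thesis by (auto simp: sum_powers_root_of_unity)
  qed
  have "(\<Sum>x<m. (\<alpha> ^ (m - 1)) ^ (z * x) * (\<Sum>y\<in>Y. \<alpha> ^ (x * y) * u y))
      = (\<Sum>x<m. \<Sum>y\<in>Y. \<gamma> y ^ x * u y)"
  proof -
    have "(\<alpha> ^ M) ^ (z * x) * (\<alpha> ^ (x * y) * v) = (\<alpha> ^ (M * z + y)) ^ x * v" for M x y v
      by (simp add: power_add power_mult_distrib mult_ac flip: power_mult)
    then show ?thesis by (simp only: sum_distrib_left \<gamma>_def)
  qed
  also have "\<dots> = (\<Sum>y\<in>Y. (\<Sum>x<m. \<gamma> y ^ x) * u y)"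
    by (subst sum.swap) (simp add: sum_distrib_right)
  also have "\<dots> = (\<Sum>y\<in>Y. if y = z then of_nat m * u z else 0)"
    using Y by (intro sum.cong) (auto simp: orth subset_iff)
  finally show ?thesis using fin by simp
qed

text \<open>If \<open>u\<close> lives on \<open>Y\<close> and its transform vanishes modulo \<open>W\<close> on \<open>Y\<close>, then the transform
  lives on the complement of \<open>Y\<close> and its inverse transform vanishes there.\<close>

lemma invertible_mod_complement:
  assumes cop: "coprime p m" and Y: "Y \<subseteq> {..<m}" and inv: "invertible_mod p m ({..<m} - Y)"
  shows "invertible_mod p m Y"
  unfolding invertible_mod_def
proof (intro allI impI)
  fix \<alpha> W u
  assume \<alpha>: "primitive_root m \<alpha>" and W: "root_module \<alpha> W"
    and pu: "\<forall>y\<in>Y. of_nat p * u y \<in> W" and F: "\<forall>x\<in>Y. (\<Sum>y\<in>Y. \<alpha> ^ (x * y) * u y) \<in> W"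
  interpret root_module \<alpha> W by (rule W)
  define w where "w x = (\<Sum>y\<in>Y. \<alpha> ^ (x * y) * u y)" for x
  define \<beta> where "\<beta> = \<alpha> ^ (m - 1)"
  have \<beta>: "primitive_root m \<beta>" unfolding \<beta>_def
    by (rule primitive_root_pow_coprime[OF \<alpha>])
      (rule coprime_diff_one_left_nat[OF primitive_root_pos[OF \<alpha>]])
  interpret \<beta>: root_module \<beta> W unfolding \<beta>_def by (rule root_module_pow)
  have dft: "(\<Sum>x<m. \<beta> ^ (z * x) * w x) = (if z \<in> Y then of_nat m * u z else 0)" if "z < m" for z
    unfolding \<beta>_def w_def by (rule fourier_inversion[OF \<alpha> Y that])
  have wY: "w x \<in> W" if "x \<in> Y" for x using F that by (simp add: w_def)
  \<comment> \<open>The hypothesis on the complement is applied with the inverse root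
    \<open>\<beta>\<close>, as \<open>invertible_mod\<close> quantifies over all primitive
    roots.\<close>
  have w_compl: "w x \<in> W" if "x \<in> {..<m} - Y" for x
  proof (rule invertible_modD[OF inv \<beta> \<beta>.root_module_axioms _ _ that])
    have "of_nat p * w x = (\<Sum>y\<in>Y. \<alpha> ^ (x * y) * (of_nat p * u y))" for x
      by (simp add: w_def sum_distrib_left mult_ac)
    then show "of_nat p * w x \<in> W" for x using pu by (auto intro: sum pow)
    fix z assume z: "z \<in> {..<m} - Y"
    have "(\<Sum>x<m. \<beta> ^ (z * x) * w x) = (\<Sum>x\<in>{..<m} - Y. \<beta> ^ (z * x) * w x) + (\<Sum>x\<in>Y. \<beta> ^ (z * x) * w x)"
      by (rule sum.subset_diff) (use Y in auto)
    then have "(\<Sum>x\<in>{..<m} - Y. \<beta> ^ (z * x) * w x) = - (\<Sum>x\<in>Y. \<beta> ^ (z * x) * w x)"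
      using dft[of z] z by (simp add: eq_neg_iff_add_eq_0)
    then show "(\<Sum>x\<in>{..<m} - Y. \<beta> ^ (z * x) * w x) \<in> W"
      by (auto intro!: uminus sum \<beta>.pow wY)
  qed
  show "\<forall>y\<in>Y. u y \<in> W"
  proof
    fix y assume y: "y \<in> Y"
    have "of_nat m * u y = (\<Sum>x<m. \<beta> ^ (y * x) * w x)" using dft[of y] y Y by auto
    also have "\<dots> \<in> W" using wY w_compl by (intro sum \<beta>.pow) auto
    finally show "u y \<in> W"
      using cancel_coprime[of "int p" "int m" "u y"] cop pu y by simp
  qed
qed

text \<open>The substitution turns the exponent \<open>x y\<close> into
  \<open>a^2 x y + a b x + a b y + b^2\<close>. The factor \<open>a^2\<close> is a change of
  primitive root; the other terms rescale rows and columns by roots of unity.\<close>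

lemma invertible_mod_affine:
  assumes a: "coprime a m" and Y: "Y \<subseteq> {..<m}"
    and inv: "invertible_mod p m ((\<lambda>y. (a * y + b) mod m) ` Y)"
  shows "invertible_mod p m Y"
  unfolding invertible_mod_def
proof (intro allI impI)
  fix \<alpha> W u
  assume \<alpha>: "primitive_root m \<alpha>" and W: "root_module \<alpha> W"
    and pu: "\<forall>y\<in>Y. of_nat p * u y \<in> W" and F: "\<forall>x\<in>Y. (\<Sum>y\<in>Y. \<alpha> ^ (x * y) * u y) \<in> W"
  interpret root_module \<alpha> W by (rule W)
  obtain c where c: "[a * c = 1] (mod m)" using a cong_solve_coprime_nat[of a m] by auto
  have cm: "coprime c m" using c
    by (metis cong_imp_coprime cong_sym coprime_1_left coprime_mult_left_iff)
  define \<phi> where "\<phi> y = (a * y + b) mod m" for y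
  \<comment> \<open>The exponent \<open>c ^ 2\<close> undoes the factor
    \<open>a ^ 2\<close>.\<close>
  define \<beta> where "\<beta> = \<alpha> ^ (c ^ 2)"
  have \<beta>: "primitive_root m \<beta>" unfolding \<beta>_def
    by (rule primitive_root_pow_coprime[OF \<alpha>]) (simp add: cm)
  interpret \<beta>: root_module \<beta> W unfolding \<beta>_def by (rule root_module_pow)
  have \<alpha>m: "\<alpha> ^ m = 1" and \<beta>m: "\<beta> ^ m = 1"
    using \<alpha> \<beta> by (simp_all add: primitive_root_pow_eq_1)
  have \<beta>a: "\<beta> ^ (a ^ 2 * k) = \<alpha> ^ k" for k
  proof -
    have "[c ^ 2 * (a ^ 2 * k) = k] (mod m)"
      using cong_mult[OF cong_pow[OF c, of 2] cong_refl[of k]]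
      by (simp add: power_mult_distrib mult_ac)
    then show ?thesis unfolding \<beta>_def power_mult[symmetric] by (rule pow_cong[OF \<alpha>m])
  qed
  have inj: "inj_on \<phi> Y"
  proof (rule inj_onI)
    fix x y assume "x \<in> Y" "y \<in> Y" "\<phi> x = \<phi> y"
    then have "[a * x + b = a * y + b] (mod m)" by (simp add: \<phi>_def cong_def)
    then have "[x = y] (mod m)"
      using a by (simp add: cong_add_rcancel_nat cong_mult_lcancel_nat)
    then show "x = y" using Y \<open>x \<in> Y\<close> \<open>y \<in> Y\<close> by (auto simp: cong_def subset_iff)
  qed
  \<comment> \<open>The inverse of the column factor \<open>\<beta> ^ (a * b * y)\<close>, absorbed
    into the transported vector \<open>u'\<close>.\<close>
  define s where "s y = \<beta> ^ ((m - 1) * (a * b * y))" for y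
  have s1: "\<beta> ^ (a * b * y) * s y = 1" for y
  proof -
    have "\<beta> ^ (a * b * y) * s y = \<beta> ^ (m * (a * b * y))"
      using primitive_root_pos[OF \<alpha>] unfolding s_def power_add[symmetric] by (cases m) auto
    then show ?thesis using \<beta>m by (simp add: power_mult)
  qed
  define u' where "u' z = s (the_inv_into Y \<phi> z) * u (the_inv_into Y \<phi> z)" for z
  have u': "u' (\<phi> y) = s y * u y" if "y \<in> Y" for y
    using that inj by (simp add: u'_def the_inv_into_f_f)
  have sW: "s y * v \<in> W" if "v \<in> W" for v y unfolding s_def using that by (rule \<beta>.pow)
  have main: "u' z \<in> W" if "z \<in> \<phi> ` Y" for z
  proof (rule invertible_modD[OF _ \<beta> \<beta>.root_module_axioms _ _ that])
    show "invertible_mod p m (\<phi> ` Y)" using inv by (simp add: \<phi>_def)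
    have "of_nat p * u' (\<phi> y) \<in> W" if "y \<in> Y" for y
      using sW[of "of_nat p * u y" y] pu that by (simp add: u' mult.left_commute)
    then show "of_nat p * u' z \<in> W" if "z \<in> \<phi> ` Y" for z
      using that by auto
    fix z assume "z \<in> \<phi> ` Y"
    then obtain x where x: "x \<in> Y" "z = \<phi> x" by blast
    have "\<beta> ^ (\<phi> x * \<phi> y) * u' (\<phi> y) = \<beta> ^ (a * b * x + b ^ 2) * (\<alpha> ^ (x * y) * u y)" if "y \<in> Y" for y
    proof -
      have "[\<phi> x * \<phi> y = (a * x + b) * (a * y + b)] (mod m)"
        unfolding \<phi>_def by (intro cong_mult) simp_all
      also have "(a * x + b) * (a * y + b) = (a * b * x + b ^ 2) + (a ^ 2 * (x * y) + a * b * y)"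
        by (simp add: algebra_simps power2_eq_square)
      finally have "\<beta> ^ (\<phi> x * \<phi> y) = \<beta> ^ (a * b * x + b ^ 2) * (\<alpha> ^ (x * y) * \<beta> ^ (a * b * y))"
        using pow_cong[OF \<beta>m] by (metis \<beta>a power_add)
      then have "\<beta> ^ (\<phi> x * \<phi> y) * u' (\<phi> y)
          = \<beta> ^ (a * b * x + b ^ 2) * \<alpha> ^ (x * y) * (\<beta> ^ (a * b * y) * s y) * u y"
        using u'[OF that] by (simp add: mult_ac)
      then show ?thesis by (simp add: s1)
    qed
    then have "(\<Sum>y\<in>\<phi> ` Y. \<beta> ^ (z * y) * u' y) = \<beta> ^ (a * b * x + b ^ 2) * (\<Sum>y\<in>Y. \<alpha> ^ (x * y) * u y)"
      by (simp add: sum.reindex[OF inj] x sum_distrib_left)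
    then show "(\<Sum>y\<in>\<phi> ` Y. \<beta> ^ (z * y) * u' y) \<in> W"
      using F x by (auto intro: \<beta>.pow)
  qed
  show "\<forall>y\<in>Y. u y \<in> W"
  proof
    fix y assume y: "y \<in> Y"
    have "s y * u y \<in> W" using main[of "\<phi> y"] u' y by auto
    then have "\<beta> ^ (a * b * y) * (s y * u y) \<in> W" by (rule \<beta>.pow)
    then show "u y \<in> W" using s1[of y] by (simp add: mult.assoc[symmetric])
  qed
qed

section \<open>Descent along the prime\<close>

text \<open>Degrees are measured by differences: the \<open>n\<close>-th difference of
  \<open>f\<close> vanishes exactly when \<open>f\<close> is a polynomial function of degree below
  \<open>n\<close>.\<close>

definition fdiff :: "(nat \<Rightarrow> int) \<Rightarrow> nat \<Rightarrow> int" where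
  "fdiff f i = f (Suc i) - f i"

lemma fdiff_pow_0: "(fdiff ^^ n) (\<lambda>_. 0) = (\<lambda>_. 0)"
  by (induction n) (auto simp: fdiff_def)

lemma fdiff_pow_mono:
  assumes "(fdiff ^^ k) f = (\<lambda>_. 0)" "k \<le> n"
  shows "(fdiff ^^ n) f = (\<lambda>_. 0)"
proof -
  have "(fdiff ^^ n) f = (fdiff ^^ (n - k)) ((fdiff ^^ k) f)"
    using assms(2) by (metis add_diff_cancel_left' comp_apply funpow_add le_add_diff_inverse2)
  then show ?thesis by (simp add: assms(1) fdiff_pow_0)
qed

lemma fdiff_pow_add:
  "(fdiff ^^ n) (\<lambda>i. f i + g i) = (\<lambda>i. (fdiff ^^ n) f i + (fdiff ^^ n) g i)"
  by (induction n) (auto simp: fdiff_def)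

lemma fdiff_pow_shift: "(fdiff ^^ n) (\<lambda>i. f (Suc i)) = (\<lambda>i. (fdiff ^^ n) f (Suc i))"
  by (induction n) (auto simp: fdiff_def)

text \<open>Induction by the discrete product rule: the difference of \<open>(i - a) f i\<close> is
  \<open>(i - a) * fdiff f i + f (Suc i)\<close>.\<close>

lemma fdiff_pow_linear_factor:
  assumes "(fdiff ^^ n) f = (\<lambda>_. 0)"
  shows "(fdiff ^^ Suc n) (\<lambda>i. (int i - a) * f i) = (\<lambda>_. 0)"
  using assms
proof (induction n arbitrary: f)
  case 0
  then show ?case by (simp add: fdiff_def fun_eq_iff)
next
  case (Suc n)
  have "fdiff (\<lambda>i. (int i - a) * f i) = (\<lambda>i. (int i - a) * fdiff f i + f (Suc i))"
    by (simp add: fdiff_def fun_eq_iff algebra_simps)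
  then have "(fdiff ^^ Suc (Suc n)) (\<lambda>i. (int i - a) * f i)
      = (\<lambda>i. (fdiff ^^ Suc n) (\<lambda>i. (int i - a) * fdiff f i) i + (fdiff ^^ Suc n) f (Suc i))"
    by (subst funpow_Suc_right) (simp only: comp_apply fdiff_pow_add fdiff_pow_shift)
  moreover have "(fdiff ^^ n) (fdiff f) = (\<lambda>_. 0)"
    using Suc.prems by (simp only: funpow_Suc_right comp_apply)
  then have "(fdiff ^^ Suc n) (\<lambda>i. (int i - a) * fdiff f i) = (\<lambda>_. 0)"
    by (rule Suc.IH)
  ultimately show ?case using Suc.prems by simp
qed

text \<open>The descent uses these products to isolate one point of a fibre, with \<open>B\<close>
  the coordinates of the other points.\<close>

lemma fdiff_pow_prod:
  "finite B \<Longrightarrow> (fdiff ^^ Suc (card B)) (\<lambda>i. \<Prod>x\<in>B. int i - int x) = (\<lambda>_. 0)"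
proof (induction B rule: finite_induct)
  case empty
  then show ?case by (simp add: fdiff_def fun_eq_iff)
next
  case (insert x B)
  have eq: "(\<lambda>i. \<Prod>y\<in>insert x B. int i - int y) = (\<lambda>i. (int i - int x) * (\<Prod>y\<in>B. int i - int y))"
    using insert.hyps by simp
  show ?case unfolding eq card_insert_disjoint[OF insert.hyps]
    by (rule fdiff_pow_linear_factor[OF insert.IH])
qed

text \<open>The linear functional sending \<open>z^i\<close> to \<open>f i\<close>. For
  \<open>f i = i^k\<close> it is the value at 1 of the \<open>k\<close>-fold operator
  \<open>z d/dz\<close>.\<close>

definition coeff_pairing :: "(nat \<Rightarrow> int) \<Rightarrow> complex poly \<Rightarrow> complex" where
  "coeff_pairing f g = (\<Sum>i\<le>degree g. of_int (f i) * coeff g i)"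

lemma coeff_pairing_altdef:
  "degree g \<le> n \<Longrightarrow> coeff_pairing f g = (\<Sum>i\<le>n. of_int (f i) * coeff g i)"
  unfolding coeff_pairing_def
  by (rule sum.mono_neutral_left) (auto simp: coeff_eq_0)

text \<open>Write \<open>z - r = (z - 1) - (r - 1)\<close>: multiplication by \<open>z\<close>
  shifts \<open>f\<close>, so the factor \<open>z - 1\<close> becomes \<open>fdiff\<close>.\<close>

lemma coeff_pairing_linear_factor:
  "coeff_pairing f ([:-r, 1:] * h)
    = coeff_pairing (fdiff f) h - (r - 1) * coeff_pairing f h"
proof -
  define n where "n = degree h"
  have deg: "degree ([:-r, 1:] * h) \<le> Suc n"
    by (rule order_trans[OF degree_mult_le]) (simp add: n_def)
  have eq: "[:-r, 1:] * h = pCons 0 h - smult r h" by simp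
  have "coeff_pairing f ([:-r, 1:] * h)
      = (\<Sum>i\<le>Suc n. of_int (f i) * coeff (pCons 0 h) i) - (\<Sum>i\<le>Suc n. of_int (f i) * (r * coeff h i))"
    by (simp only: coeff_pairing_altdef[OF deg])
      (simp only: eq coeff_diff coeff_smult right_diff_distrib sum_subtractf)
  also have "(\<Sum>i\<le>Suc n. of_int (f i) * coeff (pCons 0 h) i) = (\<Sum>i\<le>n. of_int (f (Suc i)) * coeff h i)"
    by (subst sum.atMost_Suc_shift) simp
  also have "\<dots> = coeff_pairing (fdiff f) h + coeff_pairing f h"
    by (simp add: coeff_pairing_def n_def fdiff_def algebra_simps sum.distrib sum_subtractf)
  also have "(\<Sum>i\<le>Suc n. of_int (f i) * (r * coeff h i)) = r * coeff_pairing f h"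
    by (simp add: n_def coeff_eq_0 coeff_pairing_def sum_distrib_left mult_ac)
  finally show ?thesis by (simp add: algebra_simps)
qed

context root_module
begin

lemma poly_in: "(\<And>i. coeff g i \<in> W) \<Longrightarrow> poly g (\<alpha> ^ k) \<in> W"
proof (induction g)
  case (pCons a g)
  have "coeff g i \<in> W" for i using pCons.prems[of "Suc i"] by simp
  then show ?case using pCons.IH pCons.prems[of 0] by (simp add: add pow)
qed (simp add: zero)

text \<open>By Horner's scheme the coefficients of the quotient are values of polynomials with
  coefficients in \<open>W\<close>.\<close>

lemma coeff_synthetic_div_in:
  "(\<And>i. coeff g i \<in> W) \<Longrightarrow> coeff (synthetic_div g (\<alpha> ^ k)) i \<in> W"
proof (induction g arbitrary: i)
  case (pCons a g)
  have "coeff g i \<in> W" for i using pCons.prems[of "Suc i"] by simp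
  then show ?case using pCons.IH by (auto simp: synthetic_div_pCons coeff_pCons poly_in split: nat.split)
qed (simp add: zero)

lemma diff_pow_1_in: "v \<in> W \<Longrightarrow> (\<alpha> ^ k - 1) * v \<in> (*) (\<alpha> - 1) ` W"
  by (auto intro!: image_eqI[of _ _ "(\<Sum>i<k. \<alpha> ^ i * v)"] sum pow
      simp: power_diff_1_eq mult.assoc simp flip: sum_distrib_right)

text \<open>Each root \<open>\<alpha>\<^sup>x\<close> of \<open>g\<close> is a root \<open>1\<close> modulo \<open>\<alpha> - 1\<close>, and pairing with a multiple of
  \<open>(z - 1)\<^sup>n\<close> takes \<open>n\<close>-th differences.\<close>

lemma coeff_pairing_roots:
  assumes "finite B" "inj_on (\<lambda>x. \<alpha> ^ x) B" "\<And>x. x \<in> B \<Longrightarrow> poly g (\<alpha> ^ x) = 0"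
    "\<And>i. coeff g i \<in> W" "(fdiff ^^ card B) f = (\<lambda>_. 0)"
  shows "coeff_pairing f g \<in> (*) (\<alpha> - 1) ` W"
  using assms
proof (induction B arbitrary: f g rule: finite_induct)
  case empty
  then show ?case using zero by (auto simp: coeff_pairing_def intro!: image_eqI[of _ _ 0])
next
  case (insert x B)
  define h where "h = synthetic_div g (\<alpha> ^ x)"
  have g: "g = [:-(\<alpha> ^ x), 1:] * h"
    using synthetic_div_correct'[of "\<alpha> ^ x" g] insert.prems(2)[of x] by (simp add: h_def)
  have h: "coeff h i \<in> W" for i
    unfolding h_def by (rule coeff_synthetic_div_in) (rule insert.prems)
  have roots: "poly h (\<alpha> ^ y) = 0" if "y \<in> B" for y
  proof -
    have "(\<alpha> ^ y - \<alpha> ^ x) * poly h (\<alpha> ^ y) = 0"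
      using insert.prems(2)[of y] that g by (simp add: algebra_simps)
    moreover have "\<alpha> ^ y \<noteq> \<alpha> ^ x"
      using inj_onD[OF insert.prems(1)] that insert.hyps by fastforce
    ultimately show ?thesis by simp
  qed
  have "coeff_pairing (fdiff f) h \<in> (*) (\<alpha> - 1) ` W"
    using insert.prems insert.hyps h roots
    by (intro insert.IH) (auto simp: inj_on_def funpow_swap1)
  moreover have "(\<alpha> ^ x - 1) * coeff_pairing f h \<in> (*) (\<alpha> - 1) ` W"
    by (rule diff_pow_1_in) (auto simp: coeff_pairing_def intro!: sum of_int h)
  ultimately show ?case unfolding g coeff_pairing_linear_factor
    by (rule root_module.diff[OF root_module_scale])
qed

text \<open>The powers of \<open>\<alpha>\<close> sum to zero, so \<open>p\<close> is minus the sum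
  of the differences \<open>\<alpha> ^ i - 1\<close>.\<close>

lemma prime_in:
  assumes "primitive_root p \<alpha>" "p > 1" "v \<in> W"
  shows "of_nat p * v \<in> (*) (\<alpha> - 1) ` W"
proof -
  have "\<alpha> ^ p = 1" "\<alpha> \<noteq> 1"
    using primitive_root_pow_eq_1[OF assms(1), of p] primitive_root_pow_eq_1[OF assms(1), of 1] assms(2)
    by auto
  then have "(\<Sum>i<p. \<alpha> ^ i) = 0" by (rule sum_powers_root_of_unity)
  then have "of_nat p * v = - (\<Sum>i<p. (\<alpha> ^ i - 1) * v)"
    by (simp add: sum_subtractf flip: sum_distrib_right)
  also have "\<dots> \<in> (*) (\<alpha> - 1) ` W"
    by (intro root_module.uminus[OF root_module_scale] root_module.sum[OF root_module_scale]
        diff_pow_1_in assms)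
  finally show ?thesis .
qed

end

text \<open>Splitting \<open>a\<close> into a coordinate \<open>X a\<close> modulo \<open>p\<close> and \<open>Y a\<close> modulo \<open>m\<close>, the moments
  \<open>\<Sum> f(X b) v\<^sub>b\<close> over the fibres of \<open>Y\<close> are shown to lie in \<open>(\<zeta> - 1) V\<close> by induction on the degree
  \<open>k\<close> of \<open>f\<close>. Fibres with at most \<open>k\<close> points are determined by the moments of lower degree; the others
  satisfy, modulo \<open>\<zeta> - 1\<close>, the equations of a principal minor of order \<open>m\<close>.\<close>

lemma fourier_descent:
  fixes X Y :: "'a \<Rightarrow> nat"
  assumes p: "prime p" and \<zeta>: "primitive_root p \<zeta>" and \<alpha>: "primitive_root m \<alpha>"
    and V\<zeta>: "root_module \<zeta> V" and V\<alpha>: "root_module \<alpha> V"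
    and inv: "\<And>Z. Z \<subseteq> {..<m} \<Longrightarrow> invertible_mod p m Z"
    and A: "finite A" "inj_on (\<lambda>a. (X a, Y a)) A" "\<And>a. a \<in> A \<Longrightarrow> X a < p" "\<And>a. a \<in> A \<Longrightarrow> Y a < m"
    and v: "\<And>a. a \<in> A \<Longrightarrow> v a \<in> V"
    and F: "\<And>a. a \<in> A \<Longrightarrow> (\<Sum>b\<in>A. \<zeta> ^ (X a * X b) * \<alpha> ^ (Y a * Y b) * v b) = 0"
    and a: "a \<in> A"
  shows "v a \<in> (*) (\<zeta> - 1) ` V"
proof -
  define W where "W = (*) (\<zeta> - 1) ` V"
  interpret V: root_module \<zeta> V by (rule V\<zeta>)
  interpret V\<alpha>: root_module \<alpha> V by (rule V\<alpha>)
  interpret W: root_module \<alpha> W unfolding W_def by (rule V\<alpha>.root_module_scale)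
  have p1: "p > 1" using p prime_gt_1_nat by blast
  have pV: "of_nat p * x \<in> W" if "x \<in> V" for x
    unfolding W_def by (rule V.prime_in[OF \<zeta> p1 that])
  define fib where "fib y = {b\<in>A. Y b = y}" for y
  define S where "S f y = (\<Sum>b\<in>fib y. of_int (f (X b)) * v b)" for f y
  have fin: "finite (fib y)" for y using A(1) by (simp add: fib_def)
  have Xinj: "inj_on X (fib y)" for y using A(2) by (auto simp: inj_on_def fib_def)
  have SV: "S f y \<in> V" for f y unfolding S_def by (intro V.sum V.of_int v) (auto simp: fib_def)
  \<comment> \<open>Interpolation: \<open>f\<close> vanishes at the other points of the fibre of
    \<open>b\<close>, so the moment is \<open>f (X b) * v b\<close>. Here \<open>f (X b)\<close> is
    a product of differences of distinct residues, hence prime to \<open>p\<close>.\<close>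
  have recover: "v b \<in> W" if b: "b \<in> A" "card (fib (Y b)) \<le> k"
      and IH: "\<And>f. (fdiff ^^ k) f = (\<lambda>_. 0) \<Longrightarrow> S f (Y b) \<in> W" for b k
  proof -
    define B where "B = X ` (fib (Y b) - {b})"
    define f where "f = (\<lambda>i. \<Prod>x\<in>B. int i - int x)"
    have bf: "b \<in> fib (Y b)" using b by (simp add: fib_def)
    have "card B = card (fib (Y b) - {b})"
      unfolding B_def by (rule card_image) (rule inj_on_subset[OF Xinj], auto)
    then have "Suc (card B) = card (fib (Y b))" using card.remove[OF fin bf] by simp
    moreover have finB: "finite B" using fin by (simp add: B_def)
    ultimately have "(fdiff ^^ k) f = (\<lambda>_. 0)"
      using fdiff_pow_mono[OF fdiff_pow_prod[OF finB]] b(2) by (simp add: f_def)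
    then have SfW: "S f (Y b) \<in> W" by (rule IH)
    have "f (X c) = 0" if "c \<in> fib (Y b) - {b}" for c
      using that finB by (auto simp: f_def B_def)
    then have "S f (Y b) = of_int (f (X b)) * v b"
      unfolding S_def using bf fin by (subst sum.remove[OF fin bf]) simp
    moreover have "coprime (int p) (f (X b))"
      unfolding f_def
    proof (rule prod_coprime_right)
      fix x assume "x \<in> B"
      then obtain c where c: "c \<in> A" "Y c = Y b" "c \<noteq> b" "x = X c" by (auto simp: B_def fib_def)
      have "X c \<noteq> X b" using A(2) c b by (auto simp: inj_on_def)
      moreover have "X c < p" "X b < p" using A(3) c b by auto
      ultimately have "\<not> int p dvd int (X b) - int x"
        using c(4) by (auto dest!: zdvd_imp_le[rotated] simp: dvd_diff_commute[of _ "int (X b)"])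
          (metis cong_iff_dvd_diff cong_int_iff cong_less_modulus_unique_nat)
      then show "coprime (int p) (int (X b) - int x)"
        using p by (simp add: prime_imp_coprime)
    qed
    ultimately show ?thesis
      using SfW pV[OF v[OF b(1)]] W.cancel_coprime[of "int p" "f (X b)" "v b"] by simp
  qed
  have main: "S f y \<in> W" if "(fdiff ^^ k) f = (\<lambda>_. 0)" for f y k
    using that
  proof (induction k arbitrary: f y)
    case 0
    then show ?case using W.zero by (simp add: S_def)
  next
    case (Suc k)
    \<comment> \<open>The fibres too large to be recovered from moments of degree below
      \<open>k\<close>.\<close>
    define Z where "Z = {y. y < m \<and> card (fib y) > k}"
    have small: "S f y \<in> W" if "y \<notin> Z" for y
      unfolding S_def
    proof (rule W.sum, rule W.of_int)
      fix b assume "b \<in> fib y"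
      then have "b \<in> A" "Y b = y" by (auto simp: fib_def)
      then show "v b \<in> W" using that A(4)[of b] Suc.IH by (intro recover[of b k]) (auto simp: Z_def)
    qed
    have big: "(\<Sum>z\<in>Z. \<alpha> ^ (y * z) * S f z) \<in> W" if y: "y \<in> Z" for y
    proof -
      \<comment> \<open>The equations at the points of the fibre over \<open>y\<close> say that
        \<open>g\<close> vanishes at the corresponding powers of \<open>\<zeta>\<close>. These are
        at least \<open>Suc k\<close> roots, enough for \<open>coeff_pairing_roots\<close>.\<close>
      define g where "g = (\<Sum>b\<in>A. monom (\<alpha> ^ (y * Y b) * v b) (X b))"
      have "coeff_pairing f g \<in> W"
        unfolding W_def
      proof (rule V.coeff_pairing_roots[of "X ` fib y"])
        show "finite (X ` fib y)" using fin by simp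
        have "\<zeta> ^ i \<noteq> \<zeta> ^ j" if "i < j" "j < p" for i j
        proof
          assume "\<zeta> ^ i = \<zeta> ^ j"
          moreover have "\<zeta> ^ i \<noteq> 0" using primitive_root_pow_eq_1[OF \<zeta>, of p] p1
            by (cases "\<zeta> = 0") (auto simp: power_0_left)
          ultimately have "\<zeta> ^ (j - i) = 1" using that by (simp add: power_diff)
          then show False using that primitive_root_pow_eq_1[OF \<zeta>, of "j - i"] by (auto dest: dvd_imp_le)
        qed
        then have "inj_on (\<lambda>x. \<zeta> ^ x) {..<p}"
          by (intro linorder_inj_onI') auto
        then show "inj_on (\<lambda>x. \<zeta> ^ x) (X ` fib y)"
          by (rule inj_on_subset) (use A(3) in \<open>auto simp: fib_def\<close>)
        show "poly g (\<zeta> ^ x) = 0" if "x \<in> X ` fib y" for x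
        proof -
          obtain b where b: "b \<in> A" "Y b = y" "x = X b" using that \<open>x \<in> _\<close> by (auto simp: fib_def)
          have "poly g (\<zeta> ^ x) = (\<Sum>c\<in>A. \<zeta> ^ (X b * X c) * \<alpha> ^ (Y b * Y c) * v c)"
            by (simp add: g_def poly_sum poly_monom b mult_ac flip: power_mult)
          then show ?thesis using F[OF b(1)] by simp
        qed
        show "coeff g i \<in> V" for i
          unfolding g_def coeff_sum using v by (auto intro!: V.sum V\<alpha>.pow V.zero)
        have "card (X ` fib y) = card (fib y)" by (rule card_image[OF Xinj])
        then show "(fdiff ^^ card (X ` fib y)) f = (\<lambda>_. 0)"
          using y by (intro fdiff_pow_mono[OF Suc.prems]) (simp add: Z_def)
      qed
      also have "coeff_pairing f g = (\<Sum>b\<in>A. of_int (f (X b)) * (\<alpha> ^ (y * Y b) * v b))"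
      proof -
        have deg: "degree g \<le> p"
          unfolding g_def using A(3)
          by (intro degree_sum_le A) (auto intro: order_trans[OF degree_monom_le] less_imp_le)
        have "(\<Sum>i\<le>p. of_int (f i) * coeff g i)
            = (\<Sum>b\<in>A. \<Sum>i\<le>p. if X b = i then of_int (f i) * (\<alpha> ^ (y * Y b) * v b) else 0)"
          unfolding g_def coeff_sum sum_distrib_left
          by (subst sum.swap) (auto intro!: sum.cong)
        also have "\<dots> = (\<Sum>b\<in>A. of_int (f (X b)) * (\<alpha> ^ (y * Y b) * v b))"
          using A(3) by (intro sum.cong) (auto simp: less_imp_le)
        finally show ?thesis unfolding coeff_pairing_altdef[OF deg] .
      qed
      also have "\<dots> = (\<Sum>z<m. \<alpha> ^ (y * z) * S f z)"
      proof -
        have "(\<Sum>b\<in>A. of_int (f (X b)) * (\<alpha> ^ (y * Y b) * v b))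
            = (\<Sum>z<m. \<Sum>b | b \<in> A \<and> Y b = z. of_int (f (X b)) * (\<alpha> ^ (y * Y b) * v b))"
          using A(1,4) by (intro sum.group[symmetric]) auto
        also have "\<dots> = (\<Sum>z<m. \<alpha> ^ (y * z) * S f z)"
          unfolding S_def sum_distrib_left by (intro sum.cong) (auto simp: fib_def mult_ac)
        finally show ?thesis .
      qed
      also have "\<dots> = (\<Sum>z\<in>{..<m} - Z. \<alpha> ^ (y * z) * S f z) + (\<Sum>z\<in>Z. \<alpha> ^ (y * z) * S f z)"
        by (rule sum.subset_diff) (auto simp: Z_def)
      finally have "(\<Sum>z\<in>{..<m} - Z. \<alpha> ^ (y * z) * S f z) + (\<Sum>z\<in>Z. \<alpha> ^ (y * z) * S f z) \<in> W" .
      moreover have "(\<Sum>z\<in>{..<m} - Z. \<alpha> ^ (y * z) * S f z) \<in> W"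
        by (intro W.sum W.pow small) auto
      ultimately show ?thesis by (metis W.diff add_diff_cancel_left')
    qed
    show ?case
    proof (cases "y \<in> Z")
      case True
      have "invertible_mod p m Z" by (rule inv) (auto simp: Z_def)
      then show ?thesis
        by (rule invertible_modD[OF _ \<alpha> W.root_module_axioms _ _ True]) (auto intro: pV SV big)
    qed (rule small)
  qed
  \<comment> \<open>Here \<open>k\<close> is the size of the fibre of \<open>a\<close>, and
    \<open>main\<close> supplies all moments.\<close>
  show ?thesis unfolding W_def[symmetric]
    by (rule recover[OF a order_refl main])
qed

section \<open>Reduction to minors modulo a prime\<close>

text \<open>Generators are taken over the integers, so that relations among them form an integer
  matrix.\<close>

definition int_span :: "(nat \<Rightarrow> complex) \<Rightarrow> nat \<Rightarrow> complex set" where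
  "int_span z n = {x. \<exists>c. x = (\<Sum>j<n. of_int (c j) * z j)}"

lemma int_span_base: "j < n \<Longrightarrow> z j \<in> int_span z n"
  unfolding int_span_def by (auto intro!: exI[of _ "\<lambda>i. if i = j then 1 else 0"] simp: if_distrib if_distribR cong: if_cong)

lemma int_span_zero: "0 \<in> int_span z n"
  unfolding int_span_def by (auto intro!: exI[of _ "\<lambda>_. 0"])

lemma int_span_diff: "x \<in> int_span z n \<Longrightarrow> y \<in> int_span z n \<Longrightarrow> x - y \<in> int_span z n"
proof -
  assume "x \<in> int_span z n" "y \<in> int_span z n"
  then obtain c d where "x = (\<Sum>j<n. of_int (c j) * z j)" "y = (\<Sum>j<n. of_int (d j) * z j)"
    by (auto simp: int_span_def)
  then have "x - y = (\<Sum>j<n. of_int (c j - d j) * z j)"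
    by (simp add: sum_subtractf left_diff_distrib)
  then show ?thesis unfolding int_span_def by (intro CollectI exI)
qed

lemma root_module_int_span:
  assumes "\<And>j. j < n \<Longrightarrow> \<alpha> * z j \<in> int_span z n"
  shows "root_module \<alpha> (int_span z n)"
proof
  \<comment> \<open>As a module for the root 1, the span is already closed under sums and integer
    multiples.\<close>
  interpret one: root_module 1 "int_span z n"
    by unfold_locales (auto intro: int_span_zero int_span_diff)
  show "0 \<in> int_span z n" by (rule int_span_zero)
  show "x - y \<in> int_span z n" if "x \<in> int_span z n" "y \<in> int_span z n" for x y
    using that by (rule int_span_diff)
  show "\<alpha> * x \<in> int_span z n" if x: "x \<in> int_span z n" for x
  proof -
    obtain c where "x = (\<Sum>j<n. of_int (c j) * z j)" using x by (auto simp: int_span_def)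
    then have "\<alpha> * x = (\<Sum>j<n. of_int (c j) * (\<alpha> * z j))" by (simp add: sum_distrib_left mult_ac)
    also have "\<dots> \<in> int_span z n" by (intro one.sum one.of_int assms) auto
    finally show ?thesis .
  qed
qed

text \<open>Nakayama's lemma: a matrix congruent to the identity modulo \<open>p\<close> has determinant \<open>1\<close>
  modulo \<open>p\<close>.\<close>

lemma int_span_divisible_imp_zero:
  fixes p :: nat
  assumes p: "p > 1" and div: "\<And>j. j < n \<Longrightarrow> z j \<in> (*) (of_nat p) ` int_span z n" and j: "j < n"
  shows "z j = 0"
proof -
  have "\<exists>c. z j = of_nat p * (\<Sum>k<n. of_int (c k) * z k)" if "j < n" for j
    using div[OF that] by (auto simp: int_span_def)
  then obtain c where c: "\<And>j. j < n \<Longrightarrow> z j = of_nat p * (\<Sum>k<n. of_int (c j k) * z k)"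
    by metis
  \<comment> \<open>The relations say that \<open>1 - p c\<close> annihilates the vector of
    generators.\<close>
  define M where "M = mat n n (\<lambda>(j, k). (if j = k then 1 else 0) - int p * c j k)"
  have M: "M \<in> carrier_mat n n" by (simp add: M_def)
  have "[det M = det (1\<^sub>m n)] (mod int p)"
    unfolding det_def'[OF M] det_def'[OF one_carrier_mat]
  proof (intro cong_sum cong_mult cong_prod cong_refl)
    fix \<pi> i assume "\<pi> \<in> {\<pi>. \<pi> permutes {0..<n}}" "i \<in> {0..<n}"
    then have "i < n" "\<pi> i < n" using permutes_in_image[of \<pi> "{0..<n}" i] by auto
    then show "[M $$ (i, \<pi> i) = 1\<^sub>m n $$ (i, \<pi> i)] (mod int p)"
      by (simp add: M_def cong_iff_dvd_diff)
  qed
  then have "det M \<noteq> 0"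
    using p by (auto simp: cong_iff_dvd_diff)
  then have "det (map_mat complex_of_int M) \<noteq> 0" by simp
  moreover have "map_mat complex_of_int M *\<^sub>v vec n z = 0\<^sub>v n"
  proof (intro eq_vecI)
    fix j assume "j < dim_vec (0\<^sub>v n)"
    then have j: "j < n" by simp
    have "(map_mat complex_of_int M *\<^sub>v vec n z) $ j
        = (\<Sum>k = 0..<n. (if j = k then z k else 0) - of_nat p * (of_int (c j k) * z k))"
      using j by (auto simp: scalar_prod_def M_def algebra_simps intro!: sum.cong)
    also have "\<dots> = z j - of_nat p * (\<Sum>k<n. of_int (c j k) * z k)"
      using j by (simp add: sum_subtractf sum_distrib_left lessThan_atLeast0)
    finally show "(map_mat complex_of_int M *\<^sub>v vec n z) $ j = 0\<^sub>v n $ j"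
      using c[OF j] j by simp
  qed (simp add: M_def)
  moreover have "vec n z \<in> carrier_vec n" "map_mat complex_of_int M \<in> carrier_mat n n"
    using M by simp_all
  ultimately have "vec n z = 0\<^sub>v n"
    using det_0_iff_vec_prod_zero by blast
  then show ?thesis using j by (metis index_vec index_zero_vec(1))
qed

text \<open>In the binomial expansion the outer terms \<open>\<alpha> ^ p = 1\<close> and
  \<open>(- 1) ^ p = - 1\<close> cancel, and \<open>p\<close> divides the other
  coefficients.\<close>

lemma (in root_module) diff_1_pow_prime_in:
  assumes p: "prime p" "odd p" and \<alpha>: "\<alpha> ^ p = 1" and v: "v \<in> W"
  shows "(\<alpha> - 1) ^ p * v \<in> (*) (of_nat p) ` W"
proof -
  interpret pW: root_module \<alpha> "(*) (of_nat p) ` W" by (rule root_module_scale)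
  have p0: "p > 0" using p prime_gt_0_nat by blast
  define g where "g k = of_nat (p choose k) * \<alpha> ^ k * (- 1) ^ (p - k)" for k
  have "(\<alpha> - 1) ^ p = (\<Sum>k\<le>p. g k)"
    using binomial_ring[of \<alpha> "- 1" p] by (simp add: g_def)
  also have "\<dots> = g 0 + g p + (\<Sum>k\<in>{0<..<p}. g k)"
  proof -
    have "{..p} = insert 0 (insert p {0<..<p})" using p0 by auto
    then show ?thesis using p0 by simp
  qed
  also have "g 0 + g p = 0" using p \<alpha> by (simp add: g_def)
  finally have "(\<alpha> - 1) ^ p * v = (\<Sum>k\<in>{0<..<p}. g k * v)" by (simp add: sum_distrib_right)
  also have "\<dots> \<in> (*) (of_nat p) ` W"
  proof (rule pW.sum)
    fix k assume k: "k \<in> {0<..<p}"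
    then have "p dvd p choose k" using p by (intro dvd_choose_prime) auto
    then obtain q where q: "p choose k = p * q" by blast
    have "g k * v = of_nat p * (of_int (int q * (- 1) ^ (p - k)) * (\<alpha> ^ k * v))"
      by (simp add: g_def q mult_ac)
    also have "\<dots> \<in> (*) (of_nat p) ` W" by (intro imageI of_int pow v)
    finally show "g k * v \<in> (*) (of_nat p) ` W" .
  qed
  finally show ?thesis .
qed

lemma root_module_power_scale:
  assumes "W \<subseteq> (*) t ` W"
  shows "W \<subseteq> (*) (t ^ n) ` (W :: complex set)"
proof (induction n)
  case (Suc n)
  have "W \<subseteq> (*) (t ^ n) ` ((*) t ` W)" using Suc assms by blast
  then show ?case by (simp add: image_image mult_ac power_commutes)
qed simp

lemma fourier_kernel_trivial:
  assumes p: "prime p" "odd p" and cop: "coprime p m" and \<omega>: "primitive_root (p * m) \<omega>"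
    and inv: "\<And>Z. Z \<subseteq> {..<m} \<Longrightarrow> invertible_mod p m Z"
    and A: "A \<subseteq> {..<p * m}"
    and F: "\<And>a. a \<in> A \<Longrightarrow> (\<Sum>b\<in>A. \<omega> ^ (a * b) * v b) = 0"
    and a: "a \<in> A"
  shows "v a = 0"
proof -
  define N where "N = p * m"
  have N: "N > 0" using primitive_root_pos[OF \<omega>] by (simp add: N_def)
  have p1: "p > 1" using p prime_gt_1_nat by blast
  have \<omega>N: "\<omega> ^ N = 1" using primitive_root_pow_eq_1[OF \<omega>] by (simp add: N_def)
  \<comment> \<open>\<open>e\<close> and \<open>f\<close> are the idempotents of the Chinese
    remainder theorem, so \<open>\<omega>\<close> is the product of \<open>\<omega> ^ e\<close> of
    order \<open>p\<close> and \<open>\<omega> ^ f\<close> of order \<open>m\<close>.\<close>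
  obtain e where e: "[e = 1] (mod p)" "[e = 0] (mod m)" using binary_chinese_remainder_nat[OF cop] by blast
  obtain f where f: "[f = 0] (mod p)" "[f = 1] (mod m)" using binary_chinese_remainder_nat[OF cop] by blast
  define \<zeta> where "\<zeta> = \<omega> ^ e"
  define \<alpha> where "\<alpha> = \<omega> ^ f"
  have \<zeta>: "primitive_root p \<zeta>"
  proof -
    have "coprime p e" using e(1) by (metis cong_imp_coprime cong_sym coprime_1_left coprime_commute)
    moreover have "m dvd e" using e(2) by (simp add: cong_0_iff)
    ultimately have "p * m dvd e * k \<longleftrightarrow> p dvd k" for k
      using cop by (auto simp: coprime_dvd_mult_right_iff intro: divides_mult dest: dvd_mult_left)
    then show ?thesis using p1 by (simp add: primitive_root_def \<zeta>_def primitive_root_pow_eq_1[OF \<omega>] flip: power_mult)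
  qed
  have \<alpha>: "primitive_root m \<alpha>"
  proof -
    have "coprime m f" using f(2) by (metis cong_imp_coprime cong_sym coprime_1_left coprime_commute)
    moreover have "p dvd f" using f(1) by (simp add: cong_0_iff)
    ultimately have "p * m dvd f * k \<longleftrightarrow> m dvd k" for k
      using cop by (auto simp: coprime_dvd_mult_right_iff intro: divides_mult dest: dvd_mult_right)
    moreover have "m > 0" using primitive_root_pos[OF \<omega>] by simp
    ultimately show ?thesis by (simp add: primitive_root_def \<alpha>_def primitive_root_pow_eq_1[OF \<omega>] flip: power_mult)
  qed
  define v' where "v' b = (if b \<in> A then v b else 0)" for b
  \<comment> \<open>The index \<open>b * N + i\<close> with \<open>i < N\<close> encodes the
    generator \<open>\<omega> ^ i * v b\<close>; it is zero for \<open>b\<close> outside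
    \<open>A\<close>.\<close>
  define z where "z j = \<omega> ^ (j mod N) * v' (j div N)" for j
  define V where "V = int_span z (N * N)"
  have zV: "\<omega> ^ i * v b \<in> V" if "b \<in> A" for b i
  proof -
    have "b < N" using that A by (auto simp: N_def)
    have "b * N + i mod N < Suc b * N" using N by simp
    also have "\<dots> \<le> N * N" using \<open>b < N\<close> by (intro mult_le_mono1) simp
    finally have "b * N + i mod N < N * N" .
    then have "z (b * N + i mod N) \<in> V" unfolding V_def by (rule int_span_base)
    moreover have "\<omega> ^ (i mod N) = \<omega> ^ i" by (rule pow_cong[OF \<omega>N]) simp
    ultimately show ?thesis using N that by (simp add: z_def v'_def)
  qed
  have zcases: "z j = 0 \<or> (\<exists>b\<in>A. \<exists>i. z j = \<omega> ^ i * v b)" for j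
    by (auto simp: z_def v'_def)
  interpret V: root_module \<omega> V unfolding V_def
  proof (rule root_module_int_span, fold V_def)
    fix j
    show "\<omega> * z j \<in> V"
    proof (cases "z j = 0")
      case False
      then obtain b i where "b \<in> A" "z j = \<omega> ^ i * v b" using zcases by blast
      then show ?thesis using zV[of b "Suc i"] by (simp add: mult.assoc)
    qed (simp add: V_def int_span_zero)
  qed
  interpret \<zeta>V: root_module \<zeta> V unfolding \<zeta>_def by (rule V.root_module_pow)
  interpret tV: root_module \<omega> "(*) (\<zeta> - 1) ` V" by (rule V.root_module_scale)
  have vt: "v b \<in> (*) (\<zeta> - 1) ` V" if "b \<in> A" for b
  proof (rule fourier_descent[OF p(1) \<zeta> \<alpha> \<zeta>V.root_module_axioms _ inv _ _ _ _ _ _ that,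
        where X = "\<lambda>a. a mod p" and Y = "\<lambda>a. a mod m"])
    show "root_module \<alpha> V" unfolding \<alpha>_def by (rule V.root_module_pow)
    show "finite A" using A finite_subset by blast
    show "inj_on (\<lambda>a. (a mod p, a mod m)) A"
    proof (rule inj_onI)
      fix x y assume xy: "x \<in> A" "y \<in> A" "(x mod p, x mod m) = (y mod p, y mod m)"
      then have "[x = y] (mod p * m)" by (intro coprime_cong_mult_nat cop) (auto simp: cong_def)
      then show "x = y" using xy A by (intro cong_less_modulus_unique_nat) auto
    qed
    show "a mod p < p" "a mod m < m" for a
      using p1 primitive_root_pos[OF \<alpha>] by auto
    show "v a \<in> V" if "a \<in> A" for a using zV[OF that, of 0] by simp
    fix a assume "a \<in> A"
    have "\<zeta> ^ (a mod p * (b mod p)) * \<alpha> ^ (a mod m * (b mod m)) = \<omega> ^ (a * b)" for b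
    proof -
      let ?k = "e * (a mod p * (b mod p)) + f * (a mod m * (b mod m))"
      have "[?k = 1 * (a * b) + 0 * (a mod m * (b mod m))] (mod p)"
        by (intro cong_add cong_mult e f) (simp_all add: cong_def)
      moreover have "[?k = 0 * (a mod p * (b mod p)) + 1 * (a * b)] (mod m)"
        by (intro cong_add cong_mult e f) (simp_all add: cong_def)
      ultimately have "[?k = a * b] (mod N)"
        unfolding N_def by (intro coprime_cong_mult_nat cop) simp_all
      then show ?thesis using pow_cong[OF \<omega>N]
        by (simp add: \<zeta>_def \<alpha>_def flip: power_mult power_add)
    qed
    then show "(\<Sum>b\<in>A. \<zeta> ^ (a mod p * (b mod p)) * \<alpha> ^ (a mod m * (b mod m)) * v b) = 0"
      using F[OF \<open>a \<in> A\<close>] by simp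
  qed
  have zt: "z j \<in> (*) (\<zeta> - 1) ` V" for j
    using zcases[of j] vt tV.zero tV.pow by auto
  have "V \<subseteq> (*) (\<zeta> - 1) ` V"
  proof
    fix x assume "x \<in> V"
    then obtain c where "x = (\<Sum>j<N * N. of_int (c j) * z j)" by (auto simp: V_def int_span_def)
    then show "x \<in> (*) (\<zeta> - 1) ` V" by (auto intro: tV.sum tV.of_int zt)
  qed
  then have "V \<subseteq> (*) ((\<zeta> - 1) ^ p) ` V" by (rule root_module_power_scale)
  moreover have "(*) ((\<zeta> - 1) ^ p) ` V \<subseteq> (*) (of_nat p) ` V"
    using \<zeta>V.diff_1_pow_prime_in[OF p] primitive_root_pow_eq_1[OF \<zeta>, of p] by auto
  ultimately have Vp: "V \<subseteq> (*) (of_nat p) ` V" by blast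
  have "z (a * N) = 0"
  proof (rule int_span_divisible_imp_zero[OF p1])
    show "z j \<in> (*) (of_nat p) ` int_span z (N * N)" if "j < N * N" for j
      using Vp int_span_base[OF that, of z] by (auto simp: V_def)
    show "a * N < N * N" using a A N by (auto simp: N_def)
  qed
  then show ?thesis using N a by (simp add: z_def v'_def)
qed

lemma fourier_root_primitive:
  assumes "N > 0" shows "primitive_root N (fourier_root N)"
proof -
  have "fourier_root N ^ k = 1 \<longleftrightarrow> N dvd k" for k
  proof -
    have "fourier_root N ^ k = cis (- (2 * pi * k / N))"
      by (simp add: fourier_root_def cis_conv_exp flip: exp_of_nat_mult) (simp add: mult_ac)
    then have "fourier_root N ^ k = 1 \<longleftrightarrow> cis (2 * pi * k / N) = 1"
      by (auto simp: complex_eq_iff)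
    also have "\<dots> \<longleftrightarrow> cos (2 * pi * k / N) = 1"
      by (auto simp: complex_eq_iff dest: cos_one_sin_zero)
    also have "\<dots> \<longleftrightarrow> (\<exists>j::int. 2 * pi * k / N = j * 2 * pi)" by (rule cos_one_2pi_int)
    also have "\<dots> \<longleftrightarrow> (\<exists>j::int. real k = j * N)"
      using assms by (auto simp: field_simps)
    also have "\<dots> \<longleftrightarrow> (\<exists>j::int. int k = j * int N)"
      by (metis of_int_eq_iff of_int_mult of_int_of_nat_eq)
    also have "\<dots> \<longleftrightarrow> N dvd k"
      by (metis dvd_def int_dvd_int_iff mult.commute)
    finally show ?thesis .
  qed
  then show ?thesis using assms by (simp add: primitive_root_def)
qed

text \<open>Strict monotonicity and counting. This translates indices of the submatrix into elements
  of \<open>A\<close>.\<close>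

lemma bij_betw_pick:
  assumes "finite A" shows "bij_betw (pick A) {..<card A} A"
proof -
  have "inj_on (pick A) {..<card A}"
    by (intro linorder_inj_onI') (metis lessThan_iff nat_less_le pick_mono_le)
  moreover have "pick A ` {..<card A} \<subseteq> A" using pick_in_set_le by blast
  moreover from calculation have "card (pick A ` {..<card A}) = card A" by (simp add: card_image)
  ultimately show ?thesis using assms by (simp add: bij_betw_def card_subset_eq)
qed

text \<open>A vanishing determinant gives a nonzero kernel vector; reindexed along
  \<open>pick A\<close>, it contradicts \<open>fourier_kernel_trivial\<close>.\<close>

lemma fourier_principal_minor_nonzero:
  assumes p: "prime p" "odd p" and cop: "coprime p m" and m: "m > 0"
    and inv: "\<And>Z. Z \<subseteq> {..<m} \<Longrightarrow> invertible_mod p m Z"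
    and A: "A \<subseteq> {0..<p * m}"
  shows "Determinant.det (submatrix (fourier_matrix (p * m)) A A) \<noteq> 0"
proof
  define N where "N = p * m"
  define n where "n = card A"
  define S where "S = submatrix (fourier_matrix N) A A"
  have N: "N > 0" using m p prime_gt_0_nat by (simp add: N_def)
  have fin: "finite A" using A finite_subset by blast
  have sub: "{i. i < N \<and> i \<in> A} = A" using A by (auto simp: N_def)
  have S: "S \<in> carrier_mat n n"
    unfolding S_def submatrix_def n_def by (simp add: fourier_matrix_def sub)
  have bij: "bij_betw (pick A) {..<n} A" unfolding n_def by (rule bij_betw_pick[OF fin])
  have entry: "S $$ (i, j) = fourier_root N ^ (pick A i * pick A j)" if "i < n" "j < n" for i j
  proof -
    have "pick A i < N" "pick A j < N" using that A pick_in_set_le by (auto simp: n_def N_def subset_iff)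
    then show ?thesis
      using that by (simp add: S_def submatrix_def n_def fourier_matrix_def sub)
  qed
  assume "Determinant.det (submatrix (fourier_matrix (p * m)) A A) = 0"
  then obtain x where x: "x \<in> carrier_vec n" "x \<noteq> 0\<^sub>v n" "S *\<^sub>v x = 0\<^sub>v n"
    using det_0_iff_vec_prod_zero[OF S] by (auto simp: S_def N_def)
  define v where "v b = x $ (the_inv_into {..<n} (pick A) b)" for b
  have v: "v (pick A j) = x $ j" if "j < n" for j
    using bij that by (simp add: v_def bij_betw_def the_inv_into_f_f)
  have "x $ i = 0" if i: "i < n" for i
  proof -
    have "v (pick A i) = 0"
    proof (rule fourier_kernel_trivial[OF p cop fourier_root_primitive inv])
      show "p * m > 0" using N by (simp add: N_def)
      show "A \<subseteq> {..<p * m}" using A by auto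
      show "pick A i \<in> A" using i pick_in_set_le by (simp add: n_def)
      fix a assume "a \<in> A"
      then obtain k where k: "k < n" "a = pick A k" using bij by (auto simp: bij_betw_def)
      have "(\<Sum>b\<in>A. fourier_root N ^ (a * b) * v b) = (\<Sum>j<n. S $$ (k, j) * x $ j)"
        unfolding sum.reindex_bij_betw[OF bij, symmetric] using k
        by (intro sum.cong) (auto simp: entry v)
      also have "\<dots> = (S *\<^sub>v x) $ k"
        using k S x(1) by (auto simp: scalar_prod_def lessThan_atLeast0 intro!: sum.cong)
      finally show "(\<Sum>b\<in>A. fourier_root (p * m) ^ (a * b) * v b) = 0"
        using x(3) k by (simp add: N_def)
    qed
    then show ?thesis using v[OF i] by simp
  qed
  then have "x = 0\<^sub>v n" using x(1) by (intro eq_vecI) auto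
  with x(2) show False by contradiction
qed

section \<open>Verified computation of minors\<close>

fun list_add :: "int list \<Rightarrow> int list \<Rightarrow> int list" where
  "list_add [] ys = ys"
| "list_add (x # xs) [] = x # xs"
| "list_add (x # xs) (y # ys) = (x + y) # list_add xs ys"

fun list_sub :: "int list \<Rightarrow> int list \<Rightarrow> int list" where
  "list_sub (x # xs) (y # ys) = (x - y) # list_sub xs ys"
| "list_sub _ _ = []"

fun list_mul :: "int list \<Rightarrow> int list \<Rightarrow> int list" where
  "list_mul [] ys = []"
| "list_mul (x # xs) ys = list_add (map ((*) x) ys) (0 # list_mul xs ys)"

text \<open>One fold at \<open>x^q = 1\<close> suffices for lists of length up to
  \<open>2 q\<close>, such as products of two reduced lists.\<close>

definition cyclic_reduce :: "int \<Rightarrow> nat \<Rightarrow> int list \<Rightarrow> int list" where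
  "cyclic_reduce p q xs = map (\<lambda>x. x mod p) (list_add (take q xs) (drop q xs))"

definition cyclic_mul :: "int \<Rightarrow> nat \<Rightarrow> int list \<Rightarrow> int list \<Rightarrow> int list" where
  "cyclic_mul p q xs ys = cyclic_reduce p q (list_mul xs ys)"

text \<open>Determinant, by expansion along the first row, of the matrix with entries \<open>x\<^sup>-\<^sup>e\<close> in
  \<open>\<int>[x]/(x\<^sup>q - 1)\<close>, where the exponents \<open>e \<le> q\<close> are given column by column. The inverse turns
  multiplication by a monomial into a rotation to the left.\<close>

fun cyclic_det :: "nat \<Rightarrow> nat \<Rightarrow> nat list list \<Rightarrow> int list"
and cyclic_minors :: "nat \<Rightarrow> nat \<Rightarrow> nat list list \<Rightarrow> nat list \<Rightarrow> nat list list \<Rightarrow> int list" where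
  "cyclic_det q 0 cs = 1 # replicate (q - 1) 0"
| "cyclic_det q (Suc n) cs = cyclic_minors q n [] (map hd cs) (map tl cs)"
| "cyclic_minors q n ds (e # es) (c # cs) =
    list_sub (let l = cyclic_det q n (ds @ cs) in drop e l @ take e l)
      (cyclic_minors q n (ds @ [c]) es cs)"
| "cyclic_minors q n ds _ _ = replicate q 0"

definition fourier_det :: "nat \<Rightarrow> nat list \<Rightarrow> int list" where
  "fourier_det m ys = cyclic_det m (length ys) (map (\<lambda>y. map (\<lambda>x. x * y mod m) ys) ys)"

text \<open>The substitution of \<open>- x\<close> for \<open>x\<close>, which passes from tenth to
  fifth roots of unity.\<close>

fun alternate :: "int list \<Rightarrow> int list" where
  "alternate (x # y # xs) = x # - y # alternate xs"
| "alternate xs = xs"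

fun evens :: "'a list \<Rightarrow> 'a list" where
  "evens (x # y # xs) = x # evens xs"
| "evens xs = xs"

text \<open>On lists of odd length \<open>q\<close> this is the automorphism \<open>x \<mapsto> x^((q + 1) / 2)\<close> of
  \<open>\<int>[x]/(x\<^sup>q - 1)\<close>; it generates the Galois group if \<open>2\<close> is a primitive root modulo \<open>q\<close>, as it
  is for \<open>q = 5\<close> and \<open>q = 11\<close>.\<close>

definition halve :: "int list \<Rightarrow> int list" where
  "halve xs = evens xs @ evens (tl xs)"

text \<open>The list \<open>a\<close> is the product of two conjugates; its second conjugate
  supplies the other two.\<close>

definition norm5 :: "int \<Rightarrow> int list \<Rightarrow> int list" where
  "norm5 p xs = (let a = cyclic_mul p 5 xs (halve xs) in cyclic_mul p 5 a ((halve ^^ 2) a))"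

text \<open>Doubling: \<open>a\<close>, \<open>b\<close>, \<open>c\<close> are the products of the
  first 2, 4 and 8 conjugates; the last factor supplies the remaining two.\<close>

definition norm11 :: "int \<Rightarrow> int list \<Rightarrow> int list" where
  "norm11 p xs = (let a = cyclic_mul p 11 xs (halve xs); b = cyclic_mul p 11 a ((halve ^^ 2) a);
     c = cyclic_mul p 11 b ((halve ^^ 4) b) in cyclic_mul p 11 c ((halve ^^ 8) a))"

text \<open>A norm is Galois invariant, so all its coefficients but the first agree. At a nontrivial
  \<open>q\<close>-th root of unity such a list has the value \<open>x - y\<close>.\<close>

fun nonzero_const :: "int \<Rightarrow> nat \<Rightarrow> int list \<Rightarrow> bool" where
  "nonzero_const p q (x # y # xs) \<longleftrightarrow>
    (x - y) mod p \<noteq> 0 \<and> length xs + 2 = q \<and> list_all (\<lambda>z. z = y) xs"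
| "nonzero_const p q _ \<longleftrightarrow> False"

definition minor_unit_13_11 :: "nat list \<Rightarrow> bool" where
  "minor_unit_13_11 ys \<longleftrightarrow> nonzero_const 13 11 (norm11 13 (fourier_det 11 ys))"

definition minor_unit_7_10 :: "nat list \<Rightarrow> bool" where
  "minor_unit_7_10 ys \<longleftrightarrow>
    nonzero_const 7 5 (norm5 7 (cyclic_reduce 7 5 (alternate (fourier_det 10 ys))))"

fun sublists_upto :: "nat \<Rightarrow> 'a list \<Rightarrow> 'a list list" where
  "sublists_upto (Suc k) (x # xs) = sublists_upto (Suc k) xs @ map ((#) x) (sublists_upto k xs)"
| "sublists_upto _ _ = [[]]"

section \<open>Evaluation of coefficient lists at roots of unity\<close>

lemma horner_list_add:
  "horner_sum of_int \<beta> (list_add xs ys) = horner_sum of_int \<beta> xs + horner_sum of_int (\<beta>::complex) ys"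
  by (induction xs ys rule: list_add.induct) (auto simp: algebra_simps)

lemma length_list_sub: "length (list_sub xs ys) = min (length xs) (length ys)"
  by (induction xs ys rule: list_sub.induct) auto

lemma horner_list_sub:
  "length xs = length ys \<Longrightarrow>
    horner_sum of_int \<beta> (list_sub xs ys) = horner_sum of_int \<beta> xs - horner_sum of_int (\<beta>::complex) ys"
  by (induction xs ys rule: list_sub.induct) (auto simp: right_diff_distrib)

lemma horner_map_times:
  "horner_sum of_int \<beta> (map ((*) x) xs) = of_int x * horner_sum of_int (\<beta>::complex) xs"
  by (induction xs) (auto simp: algebra_simps)

lemma horner_list_mul:
  "horner_sum of_int \<beta> (list_mul xs ys) = horner_sum of_int \<beta> xs * horner_sum of_int (\<beta>::complex) ys"
  by (induction xs) (auto simp: horner_list_add horner_map_times algebra_simps)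

lemma horner_take_drop:
  assumes "\<beta> ^ q = 1"
  shows "horner_sum of_int \<beta> (list_add (take q xs) (drop q xs)) = horner_sum of_int (\<beta>::complex) xs"
proof -
  have "horner_sum of_int \<beta> (take q xs @ drop q xs)
      = horner_sum of_int \<beta> (take q xs) + horner_sum of_int \<beta> (drop q xs)"
    unfolding horner_sum_append using assms by (cases "length xs \<le> q") (auto simp: min_def)
  then show ?thesis by (simp add: horner_list_add)
qed

lemma horner_replicate:
  "horner_sum of_int \<beta> (replicate k x) = of_int x * (\<Sum>i<k. (\<beta>::complex) ^ i)"
  by (induction k) (auto simp: sum.lessThan_Suc_shift algebra_simps sum_distrib_left simp del: sum.lessThan_Suc)

text \<open>Rotating left by \<open>n\<close> divides by \<open>\<gamma> ^ n\<close>, with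
  wrap-around because \<open>\<gamma> ^ length xs = 1\<close>.\<close>

lemma horner_rotate:
  assumes "\<alpha> * \<gamma> = 1" "\<gamma> ^ length xs = 1" "n \<le> length xs"
  shows "horner_sum of_int \<gamma> (drop n xs @ take n xs) = \<alpha> ^ n * horner_sum of_int (\<gamma>::complex) xs"
proof -
  have inv: "\<alpha> ^ n * \<gamma> ^ n = 1" using assms(1) by (metis power_mult_distrib power_one)
  have "\<gamma> ^ (length xs - n) = \<alpha> ^ n * (\<gamma> ^ n * \<gamma> ^ (length xs - n))"
    using inv by (simp add: mult.assoc[symmetric])
  also have "\<gamma> ^ n * \<gamma> ^ (length xs - n) = 1" using assms(2,3) by (simp flip: power_add)
  finally have g: "\<gamma> ^ (length xs - n) = \<alpha> ^ n" by simp
  have "horner_sum of_int \<gamma> xs = horner_sum of_int \<gamma> (take n xs @ drop n xs)" by simp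
  also have "\<dots> = horner_sum of_int \<gamma> (take n xs) + \<gamma> ^ n * horner_sum of_int \<gamma> (drop n xs)"
    unfolding horner_sum_append using assms(3) by simp
  finally show ?thesis unfolding horner_sum_append using assms(3) inv g
    by (simp add: distrib_left mult.assoc[symmetric])
qed

lemma horner_alternate:
  "horner_sum of_int (- \<gamma>) (alternate xs) = horner_sum of_int (\<gamma>::complex) xs"
  by (induction xs rule: alternate.induct) (auto simp: algebra_simps)

text \<open>\<open>ds\<close> holds the columns already passed, \<open>cs\<close> those to come, and
  \<open>es\<close> the first-row exponents of the latter. The nested subtractions produce the
  alternating signs of the Laplace expansion.\<close>

lemma cyclic_det_correct:
  assumes \<alpha>\<gamma>: "\<alpha> * \<gamma> = 1" "\<gamma> ^ q = (1::complex)" "q > 0"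
  shows "length cs = n \<Longrightarrow> (\<forall>c\<in>set cs. length c = n \<and> (\<forall>e\<in>set c. e \<le> q)) \<Longrightarrow>
      length (cyclic_det q n cs) = q \<and>
      horner_sum of_int \<gamma> (cyclic_det q n cs) = det (mat n n (\<lambda>(i, j). \<alpha> ^ (cs ! j ! i)))"
    and "length ds + length cs = Suc n \<Longrightarrow> length es = length cs \<Longrightarrow> (\<forall>e\<in>set es. e \<le> q) \<Longrightarrow>
      (\<forall>c\<in>set ds \<union> set cs. length c = n \<and> (\<forall>e\<in>set c. e \<le> q)) \<Longrightarrow>
      length (cyclic_minors q n ds es cs) = q \<and>
      horner_sum of_int \<gamma> (cyclic_minors q n ds es cs) = (\<Sum>k<length cs. (- 1) ^ k * \<alpha> ^ (es ! k) *
        det (mat n n (\<lambda>(i, j). \<alpha> ^ ((ds @ take k cs @ drop (Suc k) cs) ! j ! i))))"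
  using \<alpha>\<gamma>(2,3)
proof (induction q n cs and q n ds es cs rule: cyclic_det_cyclic_minors.induct)
  case (1 q cs)
  have "horner_sum of_int \<gamma> (replicate (q - 1) 0) = 0" by (simp add: horner_replicate)
  then show ?case using 1 by (simp add: det_def)
next
  case (2 q n cs)
  define M where "M = mat (Suc n) (Suc n) (\<lambda>(i, j). \<alpha> ^ (cs ! j ! i))"
  have M: "M \<in> carrier_mat (Suc n) (Suc n)" by (simp add: M_def)
  have len: "c \<noteq> [] \<and> length c = Suc n" if "c \<in> set cs" for c using 2 that by force
  have "det M = (\<Sum>k<Suc n. M $$ (0, k) * cofactor M 0 k)"
    by (rule laplace_expansion_row[OF M]) simp
  also have "\<dots> = (\<Sum>k<Suc n. (- 1) ^ k * \<alpha> ^ (map hd cs ! k) *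
      det (mat n n (\<lambda>(i, j). \<alpha> ^ (([] @ take k (map tl cs) @ drop (Suc k) (map tl cs)) ! j ! i))))"
  proof (rule sum.cong[OF refl])
    fix k assume "k \<in> {..<Suc n}"
    then have k: "k < Suc n" by simp
    have "mat_delete M 0 k = mat n n (\<lambda>(i, j). \<alpha> ^ (([] @ take k (map tl cs) @ drop (Suc k) (map tl cs)) ! j ! i))"
    proof (rule eq_matI)
      fix i j assume "i < dim_row (mat n n (\<lambda>(i, j). \<alpha> ^ (([] @ take k (map tl cs) @ drop (Suc k) (map tl cs)) ! j ! i)))"
        "j < dim_col (mat n n (\<lambda>(i, j). \<alpha> ^ (([] @ take k (map tl cs) @ drop (Suc k) (map tl cs)) ! j ! i)))"
      then have ij: "i < n" "j < n" by auto
      define j' where "j' = (if j < k then j else Suc j)"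
      have j': "j' < Suc n" using ij by (simp add: j'_def)
      have "(take k (map tl cs) @ drop (Suc k) (map tl cs)) ! j = tl (cs ! j')"
        using ij k 2(2) by (auto simp: nth_append j'_def min_def)
      moreover have "tl (cs ! j') ! i = cs ! j' ! Suc i"
        using len[of "cs ! j'"] j' 2(2) ij by (simp add: nth_tl)
      ultimately show "mat_delete M 0 k $$ (i, j) =
          mat n n (\<lambda>(i, j). \<alpha> ^ (([] @ take k (map tl cs) @ drop (Suc k) (map tl cs)) ! j ! i)) $$ (i, j)"
        using ij k by (auto simp: mat_delete_def M_def j'_def)
    qed (simp_all add: M_def mat_delete_def)
    moreover have "M $$ (0, k) = \<alpha> ^ (map hd cs ! k)"
      using k 2(2) len[of "cs ! k"] by (simp add: M_def hd_conv_nth)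
    ultimately show "M $$ (0, k) * cofactor M 0 k = (- 1) ^ k * \<alpha> ^ (map hd cs ! k) *
      det (mat n n (\<lambda>(i, j). \<alpha> ^ (([] @ take k (map tl cs) @ drop (Suc k) (map tl cs)) ! j ! i)))"
      by (simp add: cofactor_def)
  qed
  finally have det: "det M = \<dots>" .
  have "\<forall>c\<in>set [] \<union> set (map tl cs). length c = n \<and> (\<forall>e\<in>set c. e \<le> q)"
    using 2(3) len by (auto dest: list.set_sel(2))
  moreover have "\<forall>e\<in>set (map hd cs). e \<le> q" using 2(3) len by auto
  ultimately show ?case using 2(1) 2(2,4,5) det by (simp add: M_def)
next
  case (3 q n ds e es c cs)
  have IH1: "length (cyclic_det q n (ds @ cs)) = q"
      "horner_sum of_int \<gamma> (cyclic_det q n (ds @ cs)) = det (mat n n (\<lambda>(i, j). \<alpha> ^ ((ds @ cs) ! j ! i)))"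
    using 3(1) 3(3-) by auto
  have IH2: "length (cyclic_minors q n (ds @ [c]) es cs) = q"
    "horner_sum of_int \<gamma> (cyclic_minors q n (ds @ [c]) es cs) = (\<Sum>k<length cs. (- 1) ^ k * \<alpha> ^ (es ! k) *
        det (mat n n (\<lambda>(i, j). \<alpha> ^ (((ds @ [c]) @ take k cs @ drop (Suc k) cs) ! j ! i))))"
    using 3(2) 3(3-) by auto
  have "e \<le> q" using 3 by simp
  then have "horner_sum of_int \<gamma> (cyclic_minors q n ds (e # es) (c # cs))
      = \<alpha> ^ e * det (mat n n (\<lambda>(i, j). \<alpha> ^ ((ds @ cs) ! j ! i)))
        - horner_sum of_int \<gamma> (cyclic_minors q n (ds @ [c]) es cs)"
    using IH1 IH2(1) 3 by (simp add: Let_def horner_list_sub horner_rotate[OF \<alpha>\<gamma>(1)])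
  also have "\<dots> = (\<Sum>k<length (c # cs). (- 1) ^ k * \<alpha> ^ ((e # es) ! k) *
        det (mat n n (\<lambda>(i, j). \<alpha> ^ ((ds @ take k (c # cs) @ drop (Suc k) (c # cs)) ! j ! i))))"
    unfolding IH2(2) by (simp add: sum.lessThan_Suc_shift sum_negf del: sum.lessThan_Suc)
  finally show ?case using IH1(1) IH2(1) by (simp add: Let_def length_list_sub)
qed (auto simp: horner_replicate)

context root_module
begin

lemma horner_in: "x \<in> W \<Longrightarrow> horner_sum of_int \<alpha> xs * x \<in> W"
  by (induction xs) (auto simp: zero add of_int mult mult.assoc distrib_right)

lemma det_in:
  assumes M: "M \<in> carrier_mat n n" and x: "x \<in> W"
    and ent: "\<And>i j x. i < n \<Longrightarrow> j < n \<Longrightarrow> x \<in> W \<Longrightarrow> M $$ (i, j) * x \<in> W"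
  shows "det M * x \<in> W"
proof -
  have "(\<Prod>i\<in>I. M $$ (i, \<pi> i)) * x \<in> W" if "\<pi> permutes {0..<n}" "I \<subseteq> {0..<n}" "finite I" for \<pi> I
    using that(3,2)
  proof (induction I rule: finite_induct)
    case (insert i I)
    then show ?case
      using ent[of i "\<pi> i"] permutes_in_image[OF that(1), of i] by (simp add: mult.assoc)
  qed (simp add: x)
  then show ?thesis unfolding det_def'[OF M] sum_distrib_right
    by (intro sum) (auto simp: sign_def mult.assoc uminus)
qed

text \<open>Cramer's rule: apply the adjugate to the system. Its entries are signed minors, which
  preserve \<open>W\<close> by \<open>det_in\<close>.\<close>

lemma cramer_in:
  assumes A: "A \<in> carrier_mat n n"
    and ent: "\<And>i j x. i < n \<Longrightarrow> j < n \<Longrightarrow> x \<in> W \<Longrightarrow> A $$ (i, j) * x \<in> W"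
    and u: "\<And>i. i < n \<Longrightarrow> (\<Sum>j<n. A $$ (i, j) * u j) \<in> W" and j: "j < n"
  shows "det A * u j \<in> W"
proof -
  have adj: "(\<Sum>i<n. adj_mat A $$ (j, i) * A $$ (i, k)) = (if j = k then det A else 0)" if "k < n" for k
  proof -
    have "(adj_mat A * A) $$ (j, k) = (\<Sum>i<n. adj_mat A $$ (j, i) * A $$ (i, k))"
      using A adj_mat(1)[OF A] j that by (simp add: times_mat_def scalar_prod_def lessThan_atLeast0)
    then show ?thesis using adj_mat(3)[OF A] j that by (cases "j = k") auto
  qed
  have "(\<Sum>i<n. adj_mat A $$ (j, i) * (\<Sum>k<n. A $$ (i, k) * u k))
      = (\<Sum>i<n. \<Sum>k<n. adj_mat A $$ (j, i) * A $$ (i, k) * u k)"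
    by (simp add: sum_distrib_left mult.assoc)
  also have "\<dots> = (\<Sum>k<n. (\<Sum>i<n. adj_mat A $$ (j, i) * A $$ (i, k)) * u k)"
    by (subst sum.swap) (simp add: sum_distrib_right)
  also have "\<dots> = (\<Sum>k<n. if j = k then det A * u k else 0)"
    by (intro sum.cong) (auto simp: adj)
  also have "\<dots> = det A * u j" using j by simp
  finally have eq: "det A * u j = (\<Sum>i<n. adj_mat A $$ (j, i) * (\<Sum>k<n. A $$ (i, k) * u k))" ..
  have "adj_mat A $$ (j, i) * x \<in> W" if i: "i < n" and x: "x \<in> W" for i x
  proof -
    have "det (mat_delete A i j) * x \<in> W"
    proof (rule det_in[OF _ x])
      show "mat_delete A i j \<in> carrier_mat (n - 1) (n - 1)"
        by (rule mat_delete_carrier[OF A])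
      show "mat_delete A i j $$ (i', j') * x \<in> W" if "i' < n - 1" "j' < n - 1" "x \<in> W" for i' j' x
        using that A by (auto simp: mat_delete_def intro!: ent)
    qed
    moreover have "adj_mat A $$ (j, i) = (- 1) ^ (i + j) * det (mat_delete A i j)"
      using A i j by (simp add: adj_mat_def cofactor_def)
    ultimately show ?thesis using of_int[of _ "(- 1) ^ (i + j)"] by (simp add: mult.assoc)
  qed
  then show ?thesis unfolding eq by (intro sum) (auto intro: u)
qed

end

section \<open>Units modulo a prime\<close>

definition unit_mod :: "nat \<Rightarrow> complex \<Rightarrow> complex \<Rightarrow> bool" where
  "unit_mod p \<beta> c \<longleftrightarrow>
    (\<forall>W u. root_module \<beta> W \<longrightarrow> of_nat p * u \<in> W \<longrightarrow> c * u \<in> W \<longrightarrow> u \<in> W)"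

text \<open>Reducing coefficients changes the value by a multiple of \<open>p\<close>, which sends
  \<open>u\<close> into \<open>W\<close>.\<close>

lemma unit_mod_cyclic_reduce:
  assumes \<beta>: "\<beta> ^ q = 1" and r: "unit_mod p \<beta> (horner_sum of_int \<beta> (cyclic_reduce (int p) q xs))"
  shows "unit_mod p \<beta> (horner_sum of_int \<beta> xs)"
  unfolding unit_mod_def
proof (intro allI impI)
  fix W u assume W: "root_module \<beta> W" and pu: "of_nat p * u \<in> W" and xu: "horner_sum of_int \<beta> xs * u \<in> W"
  interpret root_module \<beta> W by (rule W)
  define ys where "ys = list_add (take q xs) (drop q xs)"
  have "horner_sum of_int \<beta> ys = horner_sum of_int \<beta> (map (\<lambda>y. y mod int p) ys)
      + of_nat p * horner_sum of_int \<beta> (map (\<lambda>y. y div int p) ys)" for ys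
  proof (induction ys)
    case (Cons y ys)
    have "complex_of_int y = of_int (y mod int p + int p * (y div int p))" by simp
    then have "complex_of_int y = of_int (y mod int p) + of_nat p * of_int (y div int p)"
      by (simp only: of_int_add of_int_mult of_int_of_nat_eq)
    then show ?case using Cons.IH by (simp add: algebra_simps)
  qed simp
  from this[of ys] have "horner_sum of_int \<beta> (cyclic_reduce (int p) q xs) * u = horner_sum of_int \<beta> xs * u
      - horner_sum of_int \<beta> (map (\<lambda>y. y div int p) ys) * (of_nat p * u)"
    unfolding ys_def horner_take_drop[OF \<beta>] cyclic_reduce_def[symmetric] by (simp add: algebra_simps)
  also have "\<dots> \<in> W" by (intro diff xu horner_in pu)
  finally show "u \<in> W" using r W pu unfolding unit_mod_def by blast
qed

text \<open>A divisor of a unit is a unit, so a norm that is a unit certifies its first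
  factor.\<close>

lemma unit_mod_cyclic_mul:
  assumes \<beta>: "\<beta> ^ q = 1" and r: "unit_mod p \<beta> (horner_sum of_int \<beta> (cyclic_mul (int p) q xs ys))"
  shows "unit_mod p \<beta> (horner_sum of_int \<beta> xs)"
  unfolding unit_mod_def
proof (intro allI impI)
  fix W u assume W: "root_module \<beta> W" and pu: "of_nat p * u \<in> W" and xu: "horner_sum of_int \<beta> xs * u \<in> W"
  interpret root_module \<beta> W by (rule W)
  have "horner_sum of_int \<beta> (list_mul xs ys) * u = horner_sum of_int \<beta> ys * (horner_sum of_int \<beta> xs * u)"
    by (simp add: horner_list_mul mult_ac)
  also have "\<dots> \<in> W" by (rule horner_in[OF xu])
  finally show "u \<in> W"
    using unit_mod_cyclic_reduce[OF \<beta> r[unfolded cyclic_mul_def]] W pu unfolding unit_mod_def by blast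
qed

lemma unit_mod_nonzero_const:
  assumes p: "prime p" and \<beta>: "\<beta> ^ q = 1" "\<beta> \<noteq> 1" and c: "nonzero_const (int p) q xs"
  shows "unit_mod p \<beta> (horner_sum of_int \<beta> xs)"
  unfolding unit_mod_def
proof (intro allI impI)
  fix W u assume W: "root_module \<beta> W" and pu: "of_nat p * u \<in> W" and xu: "horner_sum of_int \<beta> xs * u \<in> W"
  interpret root_module \<beta> W by (rule W)
  obtain x y zs where xs: "xs = x # y # zs" using c by (cases "(int p, q, xs)" rule: nonzero_const.cases) auto
  then have q: "q = Suc (Suc (length zs))" and xy: "\<not> int p dvd x - y" and "list_all (\<lambda>z. z = y) zs"
    using c by auto
  then have "y # zs = replicate (q - 1) y" by (simp add: list_all_iff replicate_eqI)
  then have "horner_sum of_int \<beta> xs = of_int (x - y) + horner_sum of_int \<beta> (replicate q y)"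
    by (simp add: xs q algebra_simps)
  also have "horner_sum of_int \<beta> (replicate q y) = 0"
    by (simp add: horner_replicate sum_powers_root_of_unity[OF \<beta>])
  finally have "of_int (x - y) * u \<in> W" using xu by simp
  moreover have "coprime (int p) (x - y)" using p xy by (simp add: prime_imp_coprime)
  ultimately show "u \<in> W" using pu cancel_coprime[of "int p" "x - y" u] by simp
qed

text \<open>By Cramer's rule the determinant sends \<open>u\<close> into \<open>W\<close>. The list
  is evaluated at the inverse \<open>\<gamma>\<close> of \<open>\<alpha>\<close>, since
  \<open>cyclic_det\<close> uses negated exponents.\<close>

lemma invertible_mod_fourier_det:
  assumes ys: "distinct ys" and unit: "\<And>\<gamma>. primitive_root m \<gamma> \<Longrightarrow> unit_mod p \<gamma> (horner_sum of_int \<gamma> (fourier_det m ys))"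
  shows "invertible_mod p m (set ys)"
  unfolding invertible_mod_def
proof (intro allI impI)
  fix \<alpha> W u
  assume \<alpha>: "primitive_root m \<alpha>" and W: "root_module \<alpha> W"
    and pu: "\<forall>y\<in>set ys. of_nat p * u y \<in> W"
    and F: "\<forall>x\<in>set ys. (\<Sum>y\<in>set ys. \<alpha> ^ (x * y) * u y) \<in> W"
  interpret root_module \<alpha> W by (rule W)
  have m: "m > 0" by (rule primitive_root_pos[OF \<alpha>])
  define n where "n = length ys"
  define \<gamma> where "\<gamma> = \<alpha> ^ (m - 1)"
  have \<gamma>: "primitive_root m \<gamma>" unfolding \<gamma>_def
    by (rule primitive_root_pow_coprime[OF \<alpha>]) (rule coprime_diff_one_left_nat[OF m])
  have W\<gamma>: "root_module \<gamma> W" unfolding \<gamma>_def by (rule root_module_pow)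
  have \<alpha>m: "\<alpha> ^ m = 1" and \<gamma>m: "\<gamma> ^ m = 1" using \<alpha> \<gamma> by (simp_all add: primitive_root_pow_eq_1)
  have \<alpha>\<gamma>: "\<alpha> * \<gamma> = 1" using \<alpha>m m unfolding \<gamma>_def by (cases m) simp_all
  define A where "A = mat n n (\<lambda>(i, j). \<alpha> ^ (map (\<lambda>y. map (\<lambda>x. x * y mod m) ys) ys ! j ! i))"
  have A: "A \<in> carrier_mat n n" by (simp add: A_def)
  have entry: "A $$ (i, j) = \<alpha> ^ (ys ! i * ys ! j)" if "i < n" "j < n" for i j
    using that pow_cong[OF \<alpha>m, of "ys ! i * ys ! j mod m"] by (simp add: A_def n_def)
  have det: "horner_sum of_int \<gamma> (fourier_det m ys) = det A"
    using cyclic_det_correct(1)[OF \<alpha>\<gamma> \<gamma>m m, of "map (\<lambda>y. map (\<lambda>x. x * y mod m) ys) ys" n] m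
    by (auto simp: fourier_det_def A_def n_def less_imp_le)
  have bij: "bij_betw ((!) ys) {..<n} (set ys)"
    using ys by (simp add: n_def bij_betw_nth)
  show "\<forall>y\<in>set ys. u y \<in> W"
  proof
    fix y assume y: "y \<in> set ys"
    then obtain j where j: "j < n" "y = ys ! j" by (auto simp: in_set_conv_nth n_def)
    have "det A * u (ys ! j) \<in> W"
    proof (rule cramer_in[OF A _ _ j(1)])
      show "A $$ (i, j) * x \<in> W" if "i < n" "j < n" "x \<in> W" for i j x
        using that by (simp add: entry pow)
      fix i assume i: "i < n"
      have "(\<Sum>j<n. A $$ (i, j) * u (ys ! j)) = (\<Sum>j<n. \<alpha> ^ (ys ! i * ys ! j) * u (ys ! j))"
        using i by (intro sum.cong) (auto simp: entry)
      also have "\<dots> = (\<Sum>y\<in>set ys. \<alpha> ^ (ys ! i * y) * u y)"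
        by (rule sum.reindex_bij_betw[OF bij])
      finally show "(\<Sum>j<n. A $$ (i, j) * u (ys ! j)) \<in> W" using F i by (simp add: n_def)
    qed
    then show "u y \<in> W" using unit[OF \<gamma>] W\<gamma> pu y j unfolding unit_mod_def det by auto
  qed
qed

text \<open>The norm is a nonzero constant modulo 13; being a unit then descends through
  \<open>c\<close>, \<open>b\<close> and \<open>a\<close> to the determinant.\<close>

lemma invertible_mod_13_11:
  assumes "distinct ys" "minor_unit_13_11 ys"
  shows "invertible_mod 13 11 (set ys)"
proof (rule invertible_mod_fourier_det[OF assms(1)])
  fix \<gamma> assume \<gamma>: "primitive_root 11 \<gamma>"
  have \<gamma>11: "\<gamma> ^ 11 = 1" "\<gamma> \<noteq> 1"
    using primitive_root_pow_eq_1[OF \<gamma>, of 11] primitive_root_pow_eq_1[OF \<gamma>, of 1] by auto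
  have "unit_mod 13 \<gamma> (horner_sum of_int \<gamma> (norm11 13 (fourier_det 11 ys)))"
    by (rule unit_mod_nonzero_const[OF _ \<gamma>11]) (use assms(2) in \<open>simp_all add: minor_unit_13_11_def\<close>)
  then show "unit_mod 13 \<gamma> (horner_sum of_int \<gamma> (fourier_det 11 ys))"
    unfolding norm11_def Let_def
    by (blast dest: unit_mod_cyclic_mul[OF \<gamma>11(1), where p = 13, unfolded of_nat_numeral])
qed

text \<open>A primitive tenth root of unity is the negative of a primitive fifth root.\<close>

lemma invertible_mod_7_10:
  assumes "distinct ys" "minor_unit_7_10 ys"
  shows "invertible_mod 7 10 (set ys)"
proof (rule invertible_mod_fourier_det[OF assms(1)])
  fix \<gamma> assume \<gamma>: "primitive_root 10 \<gamma>"
  define \<beta> where "\<beta> = - \<gamma>"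
  have pow: "\<gamma> ^ 10 = 1" "\<gamma> ^ 5 \<noteq> 1" "\<gamma> ^ 2 \<noteq> 1"
    using primitive_root_pow_eq_1[OF \<gamma>, of 10] primitive_root_pow_eq_1[OF \<gamma>, of 5]
      primitive_root_pow_eq_1[OF \<gamma>, of 2] by auto
  have "(\<gamma> ^ 5) ^ 2 = 1" using pow(1) by (simp flip: power_mult)
  then have "\<gamma> ^ 5 = -1" using pow(2) power2_eq_1_iff[of "\<gamma> ^ 5"] by blast
  then have \<beta>5: "\<beta> ^ 5 = 1" by (simp add: \<beta>_def)
  have "\<gamma> ^ 2 = \<beta> ^ 2" by (simp add: \<beta>_def)
  then have "\<beta> \<noteq> 1" using pow(3) by (metis power_one)
  note \<beta> = \<beta>5 this
  have "unit_mod 7 \<beta> (horner_sum of_int \<beta> (alternate (fourier_det 10 ys)))"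
  proof -
    have "unit_mod 7 \<beta> (horner_sum of_int \<beta>
        (norm5 7 (cyclic_reduce 7 5 (alternate (fourier_det 10 ys)))))"
      by (rule unit_mod_nonzero_const[OF _ \<beta>]) (use assms(2) in \<open>simp_all add: minor_unit_7_10_def\<close>)
    then show ?thesis
      unfolding norm5_def Let_def
      by (blast dest: unit_mod_cyclic_mul[OF \<beta>(1), where p = 7, unfolded of_nat_numeral]
          unit_mod_cyclic_reduce[OF \<beta>(1), where p = 7, unfolded of_nat_numeral])
  qed
  then have "unit_mod 7 \<beta> (horner_sum of_int \<gamma> (fourier_det 10 ys))"
    by (simp add: \<beta>_def horner_alternate)
  \<comment> \<open>As \<open>\<beta> = - \<gamma>\<close>, both roots generate the same
    ring.\<close>
  moreover have "root_module \<beta> W" if "root_module \<gamma> W" for W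
  proof -
    interpret root_module \<gamma> W by (rule that)
    show ?thesis by unfold_locales (auto simp: \<beta>_def zero diff uminus mult)
  qed
  ultimately show "unit_mod 7 \<gamma> (horner_sum of_int \<gamma> (fourier_det 10 ys))"
    unfolding unit_mod_def by blast
qed

lemma filter_in_sublists_upto:
  "length (filter P xs) \<le> k \<Longrightarrow> filter P xs \<in> set (sublists_upto k xs)"
proof (induction k xs rule: sublists_upto.induct)
  case ("2_1" xs)
  then show ?case by simp
qed auto

section \<open>The cases 70 and 143\<close>

text \<open>Up to affine maps modulo 11, a singleton is \<open>{0}\<close>, and a larger set
  contains 0 and 1 with at most three further elements.\<close>

lemma minors_13_11:
  "list_all minor_unit_13_11 ([0] # map (\<lambda>xs. 0 # 1 # xs) (sublists_upto 3 [2..<11]))"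
  by code_simp

text \<open>Differences modulo 10 need not be units, so sets are only translated to contain 0,
  leaving at most four further elements.\<close>

lemma minors_7_10:
  "list_all minor_unit_7_10 (map ((#) 0) (sublists_upto 4 [1..<10]))"
  by code_simp

lemma set_filter_upt: "set (filter (\<lambda>x. x \<in> Z) [k..<m]) = Z \<inter> {k..<m}"
  by auto

lemma length_filter_upt: "length (filter (\<lambda>x. x \<in> Z) [k..<m]) = card (Z \<inter> {k..<m})"
  by (metis set_filter_upt distinct_card distinct_filter distinct_upt)

lemma invertible_mod_13_11_small:
  assumes Z: "Z \<subseteq> {..<11}" "card Z \<le> 5"
  shows "invertible_mod 13 11 Z"
proof (cases "Z = {}")
  case True
  then show ?thesis by (simp add: invertible_mod_def)
next
  case False
  then obtain y where y: "y \<in> Z" by blast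
  have y11: "y < 11" using y Z(1) by auto
  show ?thesis
  proof (cases "Z = {y}")
    case True
    have "invertible_mod 13 11 (set [0])"
      using minors_13_11 by (intro invertible_mod_13_11) simp_all
    then have "invertible_mod 13 11 ((\<lambda>x. (1 * x + (11 - y)) mod 11) ` Z)"
      using True y11 by simp
    then show ?thesis by (rule invertible_mod_affine[rotated 2]) (use Z in simp_all)
  next
    case False
    then obtain z where z: "z \<in> Z" "z \<noteq> y" using y by blast
    have z11: "z < 11" using z Z(1) by auto
    \<comment> \<open>The sum \<open>z + (11 - y)\<close> represents \<open>z - y\<close> modulo 11
      and avoids truncated subtraction.\<close>
    have "\<not> 11 dvd z + (11 - y)" using z(2) z11 y11 by presburger
    then have "coprime (z + (11 - y)) 11"
      using prime_imp_coprime[of 11 "z + (11 - y)"] by (simp add: coprime_commute)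
    then obtain a where a: "[(z + (11 - y)) * a = 1] (mod 11)"
      using cong_solve_coprime_nat[of "z + (11 - y)" 11] by auto
    have a11: "coprime a 11" using a
      by (metis cong_imp_coprime cong_sym coprime_1_left coprime_mult_left_iff)
    \<comment> \<open>With this \<open>b\<close> the map is \<open>a * (x - y)\<close> modulo 11,
      sending \<open>y\<close> to 0 and \<open>z\<close> to 1.\<close>
    define b where "b = a * (11 - y)"
    define \<phi> where "\<phi> x = (a * x + b) mod 11" for x
    define Z' where "Z' = \<phi> ` Z"
    have "a * y + b = 11 * a" using y11 by (simp add: b_def flip: distrib_left)
    then have "\<phi> y = 0" by (simp add: \<phi>_def)
    moreover have "a * z + b = (z + (11 - y)) * a" by (simp add: b_def algebra_simps)
    then have "\<phi> z = 1" using a by (simp add: \<phi>_def cong_def)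
    ultimately have mem: "0 \<in> Z'" "1 \<in> Z'"
      using imageI[OF y, of \<phi>] imageI[OF z(1), of \<phi>] by (simp_all add: Z'_def)
    have finZ: "finite Z" using Z finite_subset by blast
    have sub: "Z' \<subseteq> {..<11}" by (auto simp: Z'_def \<phi>_def)
    have fin: "finite Z'" using sub finite_subset by blast
    have card: "card Z' \<le> 5" using card_image_le[OF finZ, of \<phi>] Z(2) by (simp add: Z'_def)
    define xs where "xs = filter (\<lambda>x. x \<in> Z') [2..<11]"
    have set_xs: "set xs = Z' \<inter> {2..<11}" unfolding xs_def by (rule set_filter_upt)
    have Z': "Z' = set (0 # 1 # xs)"
    proof -
      have "Z' \<subseteq> {0, 1} \<union> {2..<11}" using sub by force
      then show ?thesis using mem unfolding list.set set_xs by blast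
    qed
    have "Z' \<inter> {2..<11} \<subseteq> Z' - {0, 1}" by auto
    then have "card (Z' \<inter> {2..<11}) \<le> card (Z' - {0, 1})" using fin by (intro card_mono) auto
    also have "\<dots> = card Z' - 2" using mem fin by (subst card_Diff_subset) auto
    finally have "length xs \<le> 3" using card unfolding xs_def length_filter_upt by simp
    then have "xs \<in> set (sublists_upto 3 [2..<11])"
      unfolding xs_def by (rule filter_in_sublists_upto)
    then have "minor_unit_13_11 (0 # 1 # xs)"
      using minors_13_11 unfolding list_all_iff by auto
    then have "invertible_mod 13 11 Z'"
      unfolding Z'
      by (rule invertible_mod_13_11[rotated]) (simp add: set_xs, simp only: xs_def distinct_filter distinct_upt)
    then show ?thesis unfolding Z'_def \<phi>_def
      by (rule invertible_mod_affine[OF a11 Z(1)])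
  qed
qed

lemma invertible_mod_7_10_small:
  assumes Z: "Z \<subseteq> {..<10}" "card Z \<le> 5"
  shows "invertible_mod 7 10 Z"
proof (cases "Z = {}")
  case True
  then show ?thesis by (simp add: invertible_mod_def)
next
  case False
  then obtain y where y: "y \<in> Z" by blast
  have y10: "y < 10" using y Z(1) by auto
  define \<phi> where "\<phi> x = (1 * x + (10 - y)) mod 10" for x
  define Z' where "Z' = \<phi> ` Z"
  have "\<phi> y = 0" using y10 by (simp add: \<phi>_def)
  then have mem: "0 \<in> Z'" using imageI[OF y, of \<phi>] by (simp add: Z'_def)
  have finZ: "finite Z" using Z finite_subset by blast
  have sub: "Z' \<subseteq> {..<10}" by (auto simp: Z'_def \<phi>_def)
  have fin: "finite Z'" using sub finite_subset by blast
  have card: "card Z' \<le> 5" using card_image_le[OF finZ, of \<phi>] Z(2) by (simp add: Z'_def)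
  define xs where "xs = filter (\<lambda>x. x \<in> Z') [1..<10]"
  have set_xs: "set xs = Z' \<inter> {1..<10}" unfolding xs_def by (rule set_filter_upt)
  have Z': "Z' = set (0 # xs)"
  proof -
    have "Z' \<subseteq> {0} \<union> {1..<10}" using sub by force
    then show ?thesis using mem unfolding list.set set_xs by blast
  qed
  have "Z' \<inter> {1..<10} \<subseteq> Z' - {0}" by auto
  then have "card (Z' \<inter> {1..<10}) \<le> card (Z' - {0})" using fin by (intro card_mono) auto
  also have "\<dots> = card Z' - 1" using mem by simp
  finally have "length xs \<le> 4" using card unfolding xs_def length_filter_upt by simp
  then have "xs \<in> set (sublists_upto 4 [1..<10])"
    unfolding xs_def by (rule filter_in_sublists_upto)
  then have "minor_unit_7_10 (0 # xs)"
    using minors_7_10 unfolding list_all_iff by auto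
  then have "invertible_mod 7 10 Z'"
    unfolding Z'
    by (rule invertible_mod_7_10[rotated]) (simp add: set_xs, simp only: xs_def distinct_filter distinct_upt)
  then show ?thesis unfolding Z'_def \<phi>_def
    by (rule invertible_mod_affine[rotated 2]) (use Z in simp_all)
qed

text \<open>Since \<open>m \<le> 2 * k + 1\<close>, either \<open>Z\<close> or its complement has at
  most \<open>k\<close> elements.\<close>

lemma invertible_mod_if_small:
  assumes cop: "coprime p m" and Z: "Z \<subseteq> {..<m}" and k: "m \<le> 2 * k + 1"
    and small: "\<And>Z. Z \<subseteq> {..<m} \<Longrightarrow> card Z \<le> k \<Longrightarrow> invertible_mod p m Z"
  shows "invertible_mod p m Z"
proof (cases "card Z \<le> k")
  case False
  have "card ({..<m} - Z) = m - card Z" using Z by (subst card_Diff_subset) (auto intro: finite_subset)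
  then have "card ({..<m} - Z) \<le> k" using False k by simp
  then show ?thesis by (intro invertible_mod_complement[OF cop Z] small) auto
qed (rule small[OF Z])

theorem theorem1p1:
  fixes N :: nat and A :: "nat set"
  assumes "N \<in> {70, 143}" and "A \<subseteq> {0..<N}"
  shows "Determinant.det (submatrix (fourier_matrix N) A A) \<noteq> 0"
proof -
  \<comment> \<open>The primes 7 and 13 are 2 modulo 5 and modulo 11 respectively, a primitive root
    in both cases; this makes them inert.\<close>
  consider "N = 7 * 10" | "N = 13 * 11" using assms(1) by auto
  then show ?thesis
  proof cases
    case 1
    have cop: "coprime (7::nat) 10" by (rule prime_imp_coprime) simp_all
    have "invertible_mod 7 10 Z" if "Z \<subseteq> {..<10}" for Z
      using invertible_mod_if_small[OF cop that, of 5] invertible_mod_7_10_small by simp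
    then show ?thesis using assms(2) unfolding 1
      by (intro fourier_principal_minor_nonzero cop) simp_all
  next
    case 2
    have cop: "coprime (13::nat) 11" by (rule prime_imp_coprime) simp_all
    have "invertible_mod 13 11 Z" if "Z \<subseteq> {..<11}" for Z
      using invertible_mod_if_small[OF cop that, of 5] invertible_mod_13_11_small by simp
    then show ?thesis using assms(2) unfolding 2
      by (intro fourier_principal_minor_nonzero cop) simp_all
  qed
qed

end
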